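(* Let $f_1:\mathbb{R}^{n_1}\to(-\infty,\infty]$, $f_2:\mathbb{R}^{n_2}\to(-\infty,\infty]$, $H:\mathbb{R}^{n_1}\times\mathbb{R}^{n_2}\to\mathbb{R}$ satisfy Assumption A, and let $F(x_1,x_2)=f_1(x_1)+f_2(x_2)+H(x_1,x_2)$. Let $\{\mathbf{x}^k\}_{k\in\mathbb{N}}=\{(x_1^k,x_2^k)\}_{k\in\mathbb{N}}$ be a sequence generated by iPALM with inertial parameters satisfying Assumption B and with step parameters $\tau_1^k,\tau_2^k$ given by the step rule (all defined in the context), and assume that $\{\mathbf{x}^k\}_{k\in\mathbb{N}}$ is bounded. If $F$ is a KL function, then the sequence $\{\mathbf{x}^k\}_{k\in\mathbb{N}}$ converges to a critical point $\mathbf{x}^*$ of $F$.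
   Context: **Assumption A.** (i) $f_1,f_2$ are proper and lower semicontinuous with $\inf f_1>-\infty$, $\inf f_2>-\infty$. (ii) $H$ is differentiable and $\inf_{\mathbb{R}^{n_1}\times\mathbb{R}^{n_2}}F>-\infty$. (iii) For each fixed $x_2$, the partial gradient $x_1\mapsto\nabla_{x_1}H(x_1,x_2)$ is globally Lipschitz on $\mathbb{R}^{n_1}$ with modulus $L_1(x_2)$; for each fixed $x_1$, $x_2\mapsto\nabla_{x_2}H(x_1,x_2)$ is globally Lipschitz on $\mathbb{R}^{n_2}$ with modulus $L_2(x_1)$. (iv) There exist $\lambda_i^-,\lambda_i^+>0$, $i=1,2$, such that $\lambda_1^-\le\inf\{L_1(x_2):x_2\in B_2\}$, $\sup\{L_1(x_2):x_2\in B_2\}\le\lambda_1^+$, $\lambda_2^-\le\inf\{L_2(x_1):x_1\in B_1\}$, $\sup\{L_2(x_1):x_1\in B_1\}\le\lambda_2^+$ for any compact sets $B_i\subseteq\mathbb{R}^{n_i}$, $i=1,2$. (v) $\nabla H$ is Lipschitz continuous on bounded subsets of $\mathbb{R}^{n_1}\times\mathbb{R}^{n_2}$. **Proximal map.** For $\sigma:\mathbb{R}^d\to(-\infty,\infty]$ proper and lower semicontinuous and $t>0$, $\mathrm{prox}_t^\sigma(p)=\operatorname{argmin}_{q\in\mathbb{R}^d}\{\sigma(q)+\frac t2\|q-p\|^2\}$ (a set). **iPALM.** Start from initial points $\mathbf{x}^0,\mathbf{x}^1\in\mathbb{R}^{n_1}\times\mathbb{R}^{n_2}$. For $k=1,2,\ldots$,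 with $\alpha_i^k,\beta_i^k\in[0,1]$ and $\tau_i^k>0$ ($i=1,2$), set $y_i^k=x_i^k+\alpha_i^k(x_i^k-x_i^{k-1})$, $z_i^k=x_i^k+\beta_i^k(x_i^k-x_i^{k-1})$, and take $$x_1^{k+1}\in\mathrm{prox}_{\tau_1^k}^{f_1}\Big(y_1^k-\tfrac1{\tau_1^k}\nabla_{x_1}H(z_1^k,x_2^k)\Big),\qquad x_2^{k+1}\in\mathrm{prox}_{\tau_2^k}^{f_2}\Big(y_2^k-\tfrac1{\tau_2^k}\nabla_{x_2}H(x_1^{k+1},z_2^k)\Big).$$ **Assumption B.** $\varepsilon>0$ is a fixed (arbitrarily small) number, and for $i=1,2$ there exist $0<\bar\alpha_i<\frac12(1-\varepsilon)$ and $\bar\beta_i>0$ such that $0\le\alpha_i^k\le\bar\alpha_i$ and $0\le\beta_i^k\le\bar\beta_i$ for all $k$. **Step rule.** With the constants $\delta_i=\dfrac{\bar\alpha_i+\bar\beta_i}{1-\varepsilon-2\bar\alpha_i}\lambda_i^+$, $i=1,2$, for all $k$: $$\tau_1^k=\frac{(1+\varepsilon)\delta_1+(1+\beta_1^k)L_1(x_2^k)}{1-\alpha_1^k},\qquad \tau_2^k=\frac{(1+\varepsilon)\delta_2+(1+\beta_2^k)L_2(x_1^{k+1})}{1-\alpha_2^k}.$$ **Critical points, KL functions.** $\partial\sigma$ denotes the limiting (Mordukhovich) subdifferential; a critical point of $\sigma$ is a point $u\in\mathrm{dom}\,\sigma$ with $0\in\partial\sigma(u)$. For $\eta\in(0,\infty]$,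 $\Phi_\eta$ is the class of continuous functions $\varphi:[0,\eta)\to[0,\infty)$ with $\varphi(0)=0$, $\varphi\in C^1$ on $(0,\eta)$ and $\varphi'(s)>0$ for all $s\in(0,\eta)$. A proper lower semicontinuous $\sigma:\mathbb{R}^d\to(-\infty,\infty]$ has the KL (Kurdyka-Łojasiewicz) property at $\bar u\in\mathrm{dom}\,\partial\sigma$ if there exist $\eta\in(0,\infty]$, a neighborhood $U$ of $\bar u$ and $\varphi\in\Phi_\eta$ such that $\varphi'(\sigma(u)-\sigma(\bar u))\,\mathrm{dist}(0,\partial\sigma(u))\ge1$ for all $u\in U$ with $\sigma(\bar u)<\sigma(u)<\sigma(\bar u)+\eta$, where $\mathrm{dist}(x,S)=\inf\{\|y-x\|:y\in S\}$ and $\mathrm{dist}(x,\emptyset)=\infty$. $\sigma$ is a KL function if it has the KL property at every point of $\mathrm{dom}\,\partial\sigma$. *)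

theory Defs
  imports "HOL-Analysis.Analysis"
begin

section \<open>Extended-real-valued functions\<close>

definition proper :: "('a \<Rightarrow> ereal) \<Rightarrow> bool" where
  "proper f \<longleftrightarrow> (\<forall>x. f x \<noteq> -\<infinity>) \<and> (\<exists>x. f x \<noteq> \<infinity>)"

definition lsc :: "('a::topological_space \<Rightarrow> ereal) \<Rightarrow> bool" where
  "lsc f \<longleftrightarrow> (\<forall>x. f x \<le> Liminf (at x) f)"

definition edom :: "('a \<Rightarrow> ereal) \<Rightarrow> 'a set" where
  "edom f = {x. f x < \<infinity>}"

definition prox :: "real \<Rightarrow> ('a::euclidean_space \<Rightarrow> ereal) \<Rightarrow> 'a \<Rightarrow> 'a set" where
  "prox t f p = {q. is_arg_min (\<lambda>q. f q + ereal (t / 2 * (norm (q - p))\<^sup>2)) (\<lambda>_. True) q}"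


section \<open>Subdifferentials and critical points\<close>

text \<open>The Frechet (regular) subdifferential, from which the limiting one is built.\<close>

definition frechet_subdiff :: "('a::euclidean_space \<Rightarrow> ereal) \<Rightarrow> 'a \<Rightarrow> 'a set" where
  "frechet_subdiff f x =
     (if x \<in> edom f
      then {v. 0 \<le> Liminf (at x) (\<lambda>y. (f y - f x - ereal (v \<bullet> (y - x))) / ereal (norm (y - x)))}
      else {})"

text \<open>The limiting (Mordukhovich) subdifferential: the approximating points must converge
  to \<open>x\<close> together with their function values.\<close>

definition limiting_subdiff :: "('a::euclidean_space \<Rightarrow> ereal) \<Rightarrow> 'a \<Rightarrow> 'a set" where
  "limiting_subdiff f x =
     (if x \<in> edom f
      then {v. \<exists>y w. y \<longlonglongrightarrow> x \<and> (\<lambda>k. f (y k)) \<longlonglongrightarrow> f x \<and>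
                     (\<forall>k. w k \<in> frechet_subdiff f (y k)) \<and> w \<longlonglongrightarrow> v}
      else {})"

definition dom_subdiff :: "('a::euclidean_space \<Rightarrow> ereal) \<Rightarrow> 'a set" where
  "dom_subdiff f = {x. limiting_subdiff f x \<noteq> {}}"

definition critical_point :: "('a::euclidean_space \<Rightarrow> ereal) \<Rightarrow> 'a \<Rightarrow> bool" where
  "critical_point f x \<longleftrightarrow> x \<in> edom f \<and> 0 \<in> limiting_subdiff f x"


section \<open>The Kurdyka-Lojasiewicz property\<close>

text \<open>Concavity of the desingularizing functions is not required. Only the values of
  \<open>\<phi>\<close> on \<open>[0,\<eta>)\<close> matter.\<close>

definition desingularizing :: "ereal \<Rightarrow> (real \<Rightarrow> real) set" where
  "desingularizing \<eta> = {\<phi>.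
     continuous_on {s. 0 \<le> s \<and> ereal s < \<eta>} \<phi> \<and>
     (\<forall>s. 0 \<le> s \<and> ereal s < \<eta> \<longrightarrow> 0 \<le> \<phi> s) \<and>
     \<phi> 0 = 0 \<and>
     \<phi> C1_differentiable_on {s. 0 < s \<and> ereal s < \<eta>} \<and>
     (\<forall>s. 0 < s \<and> ereal s < \<eta> \<longrightarrow> 0 < deriv \<phi> s)}"

text \<open>The infimum is taken in \<^typ>\<open>ereal\<close>, so the distance to the empty set is \<open>\<infinity>\<close>
  (in contrast to \<^const>\<open>infdist\<close>).\<close>

definition edist :: "'a::real_normed_vector \<Rightarrow> 'a set \<Rightarrow> ereal" where
  "edist x S = (INF y\<in>S. ereal (norm (y - x)))"

definition KL_at :: "('a::euclidean_space \<Rightarrow> ereal) \<Rightarrow> 'a \<Rightarrow> bool" where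
  "KL_at f a \<longleftrightarrow>
     (\<exists>\<eta> U \<phi>. 0 < \<eta> \<and> open U \<and> a \<in> U \<and> \<phi> \<in> desingularizing \<eta> \<and>
        (\<forall>u\<in>U. f a < f u \<and> f u < f a + \<eta> \<longrightarrow>
           1 \<le> ereal (deriv \<phi> (real_of_ereal (f u - f a))) * edist 0 (limiting_subdiff f u)))"

definition KL_function :: "('a::euclidean_space \<Rightarrow> ereal) \<Rightarrow> bool" where
  "KL_function f \<longleftrightarrow> proper f \<and> lsc f \<and> (\<forall>a\<in>dom_subdiff f. KL_at f a)"


section \<open>The optimization problem\<close>

definition gradient :: "('a::euclidean_space \<Rightarrow> real) \<Rightarrow> 'a \<Rightarrow> 'a" where
  "gradient h x = (THE D. GDERIV h x :> D)"

definition grad1 :: "('a::euclidean_space \<times> 'b::euclidean_space \<Rightarrow> real) \<Rightarrow> 'a \<Rightarrow> 'b \<Rightarrow> 'a" where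
  "grad1 H x1 x2 = gradient (\<lambda>u. H (u, x2)) x1"

definition grad2 :: "('a::euclidean_space \<times> 'b::euclidean_space \<Rightarrow> real) \<Rightarrow> 'a \<Rightarrow> 'b \<Rightarrow> 'b" where
  "grad2 H x1 x2 = gradient (\<lambda>u. H (x1, u)) x2"

definition objective ::
  "('a::euclidean_space \<Rightarrow> ereal) \<Rightarrow> ('b::euclidean_space \<Rightarrow> ereal) \<Rightarrow> ('a \<times> 'b \<Rightarrow> real) \<Rightarrow> 'a \<times> 'b \<Rightarrow> ereal"
where
  "objective f1 f2 H = (\<lambda>(x1, x2). f1 x1 + f2 x2 + ereal (H (x1, x2)))"

text \<open>The moduli \<open>L1\<close>, \<open>L2\<close> and the bounds \<open>lm\<^sub>i\<close> (\<open>\<lambda>\<^sub>i\<^sup>-\<close>) and \<open>lp\<^sub>i\<close> (\<open>\<lambda>\<^sub>i\<^sup>+\<close>) are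
  parameters because the algorithm's step sizes depend on them. The bounds are uniform over
  all compact sets; infima and suprema are taken in \<^typ>\<open>ereal\<close>, so that empty sets impose
  no condition.\<close>

definition assumption_A ::
  "('a::euclidean_space \<Rightarrow> ereal) \<Rightarrow> ('b::euclidean_space \<Rightarrow> ereal) \<Rightarrow> ('a \<times> 'b \<Rightarrow> real) \<Rightarrow>
   ('b \<Rightarrow> real) \<Rightarrow> ('a \<Rightarrow> real) \<Rightarrow> real \<Rightarrow> real \<Rightarrow> real \<Rightarrow> real \<Rightarrow> bool"
where
  "assumption_A f1 f2 H L1 L2 lm1 lp1 lm2 lp2 \<longleftrightarrow>
     proper f1 \<and> lsc f1 \<and> (INF x. f1 x) > -\<infinity> \<and>
     proper f2 \<and> lsc f2 \<and> (INF x. f2 x) > -\<infinity> \<and>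
     (\<forall>x. H differentiable (at x)) \<and> (INF x. objective f1 f2 H x) > -\<infinity> \<and>
     (\<forall>x2. (L1 x2)-lipschitz_on UNIV (\<lambda>x1. grad1 H x1 x2)) \<and>
     (\<forall>x1. (L2 x1)-lipschitz_on UNIV (\<lambda>x2. grad2 H x1 x2)) \<and>
     0 < lm1 \<and> 0 < lp1 \<and> 0 < lm2 \<and> 0 < lp2 \<and>
     (\<forall>B1 B2. compact B1 \<and> compact B2 \<longrightarrow>
        ereal lm1 \<le> (INF x2\<in>B2. ereal (L1 x2)) \<and> (SUP x2\<in>B2. ereal (L1 x2)) \<le> ereal lp1 \<and>
        ereal lm2 \<le> (INF x1\<in>B1. ereal (L2 x1)) \<and> (SUP x1\<in>B1. ereal (L2 x1)) \<le> ereal lp2) \<and>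
     (\<forall>B. bounded B \<longrightarrow> (\<exists>M. M-lipschitz_on B (gradient H)))"


section \<open>The algorithm\<close>

definition iPALM ::
  "('a::euclidean_space \<Rightarrow> ereal) \<Rightarrow> ('b::euclidean_space \<Rightarrow> ereal) \<Rightarrow> ('a \<times> 'b \<Rightarrow> real) \<Rightarrow>
   (nat \<Rightarrow> real) \<Rightarrow> (nat \<Rightarrow> real) \<Rightarrow> (nat \<Rightarrow> real) \<Rightarrow> (nat \<Rightarrow> real) \<Rightarrow> (nat \<Rightarrow> real) \<Rightarrow> (nat \<Rightarrow> real) \<Rightarrow>
   (nat \<Rightarrow> 'a) \<Rightarrow> (nat \<Rightarrow> 'b) \<Rightarrow> bool"
where
  "iPALM f1 f2 H \<alpha>1 \<alpha>2 \<beta>1 \<beta>2 \<tau>1 \<tau>2 x1 x2 \<longleftrightarrow>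
     (\<forall>k\<ge>1.
        \<alpha>1 k \<in> {0..1} \<and> \<alpha>2 k \<in> {0..1} \<and> \<beta>1 k \<in> {0..1} \<and> \<beta>2 k \<in> {0..1} \<and> 0 < \<tau>1 k \<and> 0 < \<tau>2 k \<and>
        (let y1 = x1 k + \<alpha>1 k *\<^sub>R (x1 k - x1 (k - 1));
             z1 = x1 k + \<beta>1 k *\<^sub>R (x1 k - x1 (k - 1));
             y2 = x2 k + \<alpha>2 k *\<^sub>R (x2 k - x2 (k - 1));
             z2 = x2 k + \<beta>2 k *\<^sub>R (x2 k - x2 (k - 1))
         in x1 (k + 1) \<in> prox (\<tau>1 k) f1 (y1 - (1 / \<tau>1 k) *\<^sub>R grad1 H z1 (x2 k)) \<and>
            x2 (k + 1) \<in> prox (\<tau>2 k) f2 (y2 - (1 / \<tau>2 k) *\<^sub>R grad2 H (x1 (k + 1)) z2)))"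

text \<open>The condition on one block; \<open>ab\<close> and \<open>bb\<close> stand for the bounds with a bar.\<close>

definition assumption_B :: "real \<Rightarrow> real \<Rightarrow> real \<Rightarrow> (nat \<Rightarrow> real) \<Rightarrow> (nat \<Rightarrow> real) \<Rightarrow> bool" where
  "assumption_B \<epsilon> ab bb \<alpha> \<beta> \<longleftrightarrow>
     0 < ab \<and> ab < (1 - \<epsilon>) / 2 \<and> 0 < bb \<and>
     (\<forall>k\<ge>1. 0 \<le> \<alpha> k \<and> \<alpha> k \<le> ab \<and> 0 \<le> \<beta> k \<and> \<beta> k \<le> bb)"

definition step_delta :: "real \<Rightarrow> real \<Rightarrow> real \<Rightarrow> real \<Rightarrow> real" where
  "step_delta \<epsilon> ab bb lp = (ab + bb) / (1 - \<epsilon> - 2 * ab) * lp"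

definition step_rule ::
  "real \<Rightarrow> real \<Rightarrow> real \<Rightarrow> ('b \<Rightarrow> real) \<Rightarrow> ('a \<Rightarrow> real) \<Rightarrow>
   (nat \<Rightarrow> real) \<Rightarrow> (nat \<Rightarrow> real) \<Rightarrow> (nat \<Rightarrow> real) \<Rightarrow> (nat \<Rightarrow> real) \<Rightarrow> (nat \<Rightarrow> real) \<Rightarrow> (nat \<Rightarrow> real) \<Rightarrow>
   (nat \<Rightarrow> 'a) \<Rightarrow> (nat \<Rightarrow> 'b) \<Rightarrow> bool"
where
  "step_rule \<epsilon> \<delta>1 \<delta>2 L1 L2 \<alpha>1 \<alpha>2 \<beta>1 \<beta>2 \<tau>1 \<tau>2 x1 x2 \<longleftrightarrow>
     (\<forall>k\<ge>1. \<tau>1 k = ((1 + \<epsilon>) * \<delta>1 + (1 + \<beta>1 k) * L1 (x2 k)) / (1 - \<alpha>1 k) \<and>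
            \<tau>2 k = ((1 + \<epsilon>) * \<delta>2 + (1 + \<beta>2 k) * L2 (x1 (k + 1))) / (1 - \<alpha>2 k))"

end

theory Submission
  imports Defs
begin

text \<open>The desingularizing functions are not assumed concave, so the usual estimate of the step
  lengths through \<open>\<phi>(V\<^sub>k) - \<phi>(V\<^sub>k\<^sub>+\<^sub>1) \<ge> \<phi>'(V\<^sub>k) (V\<^sub>k - V\<^sub>k\<^sub>+\<^sub>1)\<close> is not available. Instead, the KL
  inequality is used as an error bound: if \<open>F > s\<close> on the ball of radius \<open>R\<close> about \<open>u\<close>, then
  \<open>R / 2 \<le> \<phi>(F(u) - A) - \<phi>(s - A)\<close>. Since the proximal steps are global minimizations, for
  points \<open>u\<close> with \<open>\<parallel>u - x\<^sup>k\<parallel> \<le> \<kappa> d\<^sub>k\<^sub>+\<^sub>1\<close>, where \<open>d\<^sub>k = \<parallel>x\<^sup>k - x\<^sup>k\<^sup>-\<^sup>1\<parallel>\<close>, one has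
  \<open>F(u) > \<Psi>\<^sub>k\<^sub>+\<^sub>1 - b d\<^sub>k\<^sup>2\<close> with the Lyapunov values \<open>\<Psi>\<^sub>k = F(x\<^sup>k) + \<Sum>\<^sub>i \<delta>\<^sub>i/2 \<parallel>x\<^sub>i\<^sup>k - x\<^sub>i\<^sup>k\<^sup>-\<^sup>1\<parallel>\<^sup>2\<close>.
  Hence, for a fixed large \<open>m\<close>, either \<open>\<Psi>\<close> drops by \<open>b d\<^sub>k\<^sup>2\<close> during the steps \<open>k+1, \<dots>, k+m\<close>, and
  \<open>d\<^sub>k\<^sub>+\<^sub>1\<close> is paid for by the drop of \<open>\<phi>\<close> over \<open>m+1\<close> steps, or by sufficient decrease \<open>d\<^sub>k\<close>
  dominates the next \<open>m\<close> steps. A run of \<open>m\<close> dominating steps halves the step length, so the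
  lengths are summable as long as the iterates stay near a cluster point, and therefore they
  do stay there.\<close>

section \<open>Lower semicontinuity and subgradients\<close>

lemma closed_epigraph_if_lsc:
  fixes f :: "'a::metric_space \<Rightarrow> ereal"
  assumes "lsc f"
  shows "closed {(u, t). f u \<le> ereal t}"
  unfolding closed_sequential_limits
proof (intro allI impI)
  fix p l assume *: "(\<forall>n. p n \<in> {(u, t). f u \<le> ereal t}) \<and> p \<longlonglongrightarrow> l"
  obtain u t where l: "l = (u, t)" by (cases l)
  have pu: "(\<lambda>n. fst (p n)) \<longlonglongrightarrow> u" and pt: "(\<lambda>n. snd (p n)) \<longlonglongrightarrow> t"
    using tendsto_fst[of p l] tendsto_snd[of p l] * l by auto
  have le: "f (fst (p n)) \<le> ereal (snd (p n))" for n using * by (simp add: case_prod_unfold)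
  have "f u \<le> ereal t"
  proof (rule ccontr)
    assume "\<not> f u \<le> ereal t"
    then obtain r where r: "t < r" "ereal r < f u"
      by (metis ereal_dense2 ereal_less(2) less_ereal.simps(1) not_le)
    have "f u \<le> Liminf (at u) f" using assms by (simp add: lsc_def)
    then have "\<forall>\<^sub>F y in at u. ereal r < f y"
      using r less_LiminfD by (metis order_less_le_trans)
    \<comment> \<open>\<open>Liminf (at u)\<close> ignores \<open>u\<close> itself, but the sequence
      may hit \<open>u\<close>, so the value there is added.\<close>
    then have "\<forall>\<^sub>F y in nhds u. ereal r < f y"
      using r by (auto simp: eventually_at_filter elim: eventually_mono)
    then have "\<forall>\<^sub>F n in sequentially. ereal r < f (fst (p n))"
      using pu unfolding filterlim_iff by blast
    moreover have "\<forall>\<^sub>F n in sequentially. snd (p n) < r"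
      using pt r by (simp add: order_tendstoD)
    ultimately have "\<forall>\<^sub>F n in sequentially. False"
    proof eventually_elim
      case (elim n)
      then show ?case using le[of n] by (metis dual_order.strict_trans1 ereal_less_le less_ereal.simps(1) not_less_iff_gr_or_eq)
    qed
    then show False by simp
  qed
  then show "l \<in> {(u, t). f u \<le> ereal t}" by (simp add: l)
qed

text \<open>Trades the extended-real difference quotient for an affine minorant with error
  \<open>e * norm (y - x)\<close>. A bound \<open>r < 0\<close> on the quotient corresponds to
  \<open>e = - r\<close>.\<close>

lemma frechet_subdiffI:
  fixes f :: "'a::euclidean_space \<Rightarrow> ereal"
  assumes fx: "f x = ereal c"
    and ev: "\<And>e. e > 0 \<Longrightarrow> \<forall>\<^sub>F y in at x. ereal (c + v \<bullet> (y - x) - e * norm (y - x)) \<le> f y"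
  shows "v \<in> frechet_subdiff f x"
proof -
  have "0 \<le> Liminf (at x) (\<lambda>y. (f y - f x - ereal (v \<bullet> (y - x))) / ereal (norm (y - x)))"
    unfolding le_Liminf_iff
  proof (intro allI impI)
    fix b :: ereal assume "b < 0"
    then obtain r where r: "b < ereal r" "r < 0"
      by (metis ereal_dense2 ereal_less(2) less_ereal.simps(1) zero_ereal_def)
    have "\<forall>\<^sub>F y in at x. ereal (c + v \<bullet> (y - x) - (- r) * norm (y - x)) \<le> f y"
      using ev[of "- r"] r by simp
    moreover have "\<forall>\<^sub>F y in at x. y \<noteq> x" by (simp add: eventually_at_filter)
    ultimately show "\<forall>\<^sub>F y in at x. b < (f y - f x - ereal (v \<bullet> (y - x))) / ereal (norm (y - x))"
    proof eventually_elim
      case (elim y)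
      then have n: "norm (y - x) > 0" by simp
      show ?case
      proof (cases "f y")
        case (real t)
        then have "r \<le> (t - c - v \<bullet> (y - x)) / norm (y - x)"
          using elim n by (simp add: field_simps)
        then show ?thesis using r real fx
          by (metis ereal_divide ereal_less_eq(3) ereal_minus(1) n order_less_irrefl order_less_le_trans)
      next
        case PInf
        then show ?thesis using r n fx by (auto simp: divide_ereal_def intro: less_trans)
      next
        case MInf
        then show ?thesis using elim by simp
      qed
    qed
  qed
  then show ?thesis by (simp add: frechet_subdiff_def edom_def fx)
qed

lemma frechet_subdiff_subset_limiting:
  "frechet_subdiff f x \<subseteq> limiting_subdiff f x"
proof
  fix v assume v: "v \<in> frechet_subdiff f x"
  then have "x \<in> edom f" by (auto simp: frechet_subdiff_def split: if_splits)
  then show "v \<in> limiting_subdiff f x"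
    unfolding limiting_subdiff_def if_P[OF \<open>x \<in> edom f\<close>] mem_Collect_eq
    by (intro exI[of _ "\<lambda>_. x"] exI[of _ "\<lambda>_. v"]) (use v in auto)
qed

section \<open>The KL inequality as an error bound\<close>

lemma desingularizing_DERIV:
  assumes phi: "\<phi> \<in> desingularizing \<eta>" and t: "0 < t" "ereal t < \<eta>"
  shows "(\<phi> has_real_derivative deriv \<phi> t) (at t)" "0 < deriv \<phi> t"
proof -
  have "\<phi> differentiable at t"
    using phi t unfolding desingularizing_def C1_differentiable_on_def
    by (auto simp: has_vector_derivative_def differentiable_def)
  then show "(\<phi> has_real_derivative deriv \<phi> t) (at t)"
    by (simp add: DERIV_deriv_iff_real_differentiable)
  show "0 < deriv \<phi> t" using phi t by (auto simp: desingularizing_def)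
qed

lemma desingularizing_strict_mono:
  assumes phi: "\<phi> \<in> desingularizing \<eta>" and "0 \<le> s" "s < t" "ereal t < \<eta>"
  shows "\<phi> s < \<phi> t"
proof (rule DERIV_pos_imp_increasing_open[OF \<open>s < t\<close>])
  have sub: "ereal u < \<eta>" if "u \<le> t" for u
    using that assms(4) by (metis ereal_less_eq(3) order_le_less_trans)
  fix x assume x: "s < x" "x < t"
  then have "0 < x" "ereal x < \<eta>" using assms sub by auto
  from desingularizing_DERIV[OF phi this]
  show "\<exists>y. (\<phi> has_real_derivative y) (at x) \<and> 0 < y" by blast
next
  have sub: "ereal u < \<eta>" if "u \<le> t" for u
    using that assms(4) by (metis ereal_less_eq(3) order_le_less_trans)
  show "continuous_on {s..t} \<phi>"
    using phi by (auto simp: desingularizing_def elim!: continuous_on_subset intro: sub order_trans[OF \<open>0 \<le> s\<close>])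
qed

lemma desingularizing_mono:
  assumes "\<phi> \<in> desingularizing \<eta>" and "0 \<le> s" "s \<le> t" "ereal t < \<eta>"
  shows "\<phi> s \<le> \<phi> t"
  using desingularizing_strict_mono[OF assms(1,2) _ assms(4)] assms(3) by (cases "s = t") auto

text \<open>Otherwise minimize \<open>\<phi> (f u - A) + (norm (u - x))\<^sup>2 / (2 * R)\<close>
  over the ball. A drop of \<open>\<phi>\<close> below \<open>R / 2\<close> forces the minimizer
  into the interior, where the first-order condition yields a subgradient of \<open>f\<close> of
  norm less than \<open>1 / D\<close>, with \<open>D\<close> the slope of \<open>\<phi>\<close>
  there, against the KL inequality.\<close>

lemma KL_error_bound:
  fixes f :: "'a::euclidean_space \<Rightarrow> ereal"
  assumes lsc: "lsc f" and phi: "\<phi> \<in> desingularizing \<eta>" and fa: "f a = ereal A"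
    and KL: "\<And>u. u \<in> U \<Longrightarrow> f a < f u \<Longrightarrow> f u < f a + \<eta> \<Longrightarrow>
        1 \<le> ereal (deriv \<phi> (real_of_ereal (f u - f a))) * edist 0 (limiting_subdiff f u)"
    and R: "0 < R" and sub: "cball x R \<subseteq> U"
    and fx: "f x = ereal X" and X: "ereal (X - A) < \<eta>" and s: "A \<le> s"
    and above: "\<And>u. u \<in> cball x R \<Longrightarrow> ereal s < f u"
  shows "R / 2 \<le> \<phi> (X - A) - \<phi> (s - A)"
proof (rule ccontr)
  assume "\<not> ?thesis"
  then have small: "\<phi> (X - A) - \<phi> (s - A) < R / 2" by simp
  \<comment> \<open>Truncating strictly above \<open>X\<close> leaves room in the epigraph for
    function values slightly above the minimal level \<open>t \<le> X\<close>.\<close>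
  obtain l where l: "X < l" "ereal (l - A) < \<eta>"
  proof -
    obtain r where "ereal (X - A) < ereal r" "ereal r < \<eta>" using X ereal_dense2 by blast
    then show ?thesis using that[of "r + A"] by simp
  qed
  have below: "ereal (t - A) < \<eta>" if "t \<le> l" for t
    using that l(2) by (metis diff_right_mono ereal_less_eq(3) order_le_less_trans)
  have smono: "\<phi> (t - A) < \<phi> (t' - A)" if "s \<le> t" "t < t'" "t' \<le> l" for t t'
    by (rule desingularizing_strict_mono[OF phi]) (use that s below in auto)
  \<comment> \<open>Minimizing over the epigraph replaces the lower semicontinuous \<open>\<phi> (f u - A)\<close> by a continuous
    function; monotonicity of \<open>\<phi>\<close> puts the minimizer on the graph.\<close>
  define E where "E = (cball x R \<times> {s..l}) \<inter> {(u, t). f u \<le> ereal t}"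
  define G where "G = (\<lambda>p. \<phi> (snd p - A) + (norm (fst p - x))\<^sup>2 / (2 * R))"
  have "compact E"
    unfolding E_def by (intro compact_Int_closed compact_Times closed_epigraph_if_lsc lsc) auto
  moreover have xE: "(x, X) \<in> E" using above[of x] l(1) R fx by (auto simp: E_def)
  moreover have "continuous_on E G"
  proof -
    have c: "continuous_on {s. 0 \<le> s \<and> ereal s < \<eta>} \<phi>" using phi by (simp add: desingularizing_def)
    have "continuous_on E (\<lambda>p. \<phi> (snd p - A))"
      by (rule continuous_on_compose2[OF c]) (use s below in \<open>auto simp: E_def intro!: continuous_intros\<close>)
    then show ?thesis unfolding G_def using R by (intro continuous_intros) auto
  qed
  ultimately obtain p where p: "p \<in> E" and pmin: "\<And>q. q \<in> E \<Longrightarrow> G p \<le> G q"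
    using continuous_attains_inf[of E G] by blast
  obtain u t where ut: "p = (u, t)" by (cases p)
  have u: "u \<in> cball x R" "f u \<le> ereal t" and t: "s \<le> t" "t \<le> l" using p by (auto simp: E_def ut)
  have fu: "f u = ereal t"
  proof -
    have "ereal s < f u" using above u by auto
    then obtain T where T: "f u = ereal T" using u by (cases "f u") auto
    have "T = t"
    proof (rule ccontr)
      assume "T \<noteq> t"
      then have "s < T" "T < t" using T u \<open>ereal s < f u\<close> by auto
      then have "(u, T) \<in> E" using u t T by (auto simp: E_def)
      from pmin[OF this] show False using smono[of T t] \<open>s < T\<close> \<open>T < t\<close> t by (auto simp: G_def ut)
    qed
    then show ?thesis using T by simp
  qed
  have st: "s < t" using above[OF u(1)] fu by simp
  have Gx: "\<phi> (t - A) + (norm (u - x))\<^sup>2 / (2 * R) \<le> \<phi> (X - A)"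
    using pmin[OF xE] by (simp add: G_def ut)
  have tX: "t \<le> X"
  proof (rule ccontr)
    assume "\<not> t \<le> X"
    moreover have "s < X" using above[of x] R fx by auto
    ultimately have "\<phi> (X - A) < \<phi> (t - A)" using t by (intro smono) auto
    moreover have "0 \<le> (norm (u - x))\<^sup>2 / (2 * R)" using R by simp
    ultimately show False using Gx by linarith
  qed
  have nu: "norm (u - x) < R"
  proof -
    have "\<phi> (s - A) < \<phi> (t - A)" using st t by (intro smono) auto
    then have "(norm (u - x))\<^sup>2 / (2 * R) < R / 2" using Gx small by linarith
    then have "(norm (u - x))\<^sup>2 < R\<^sup>2" using R by (simp add: field_simps power2_eq_square)
    then show ?thesis using R by (meson less_imp_le power2_less_imp_less)
  qed
  define D where "D = deriv \<phi> (t - A)"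
  have tl: "t < l" and tA: "0 < t - A" using tX l st s by auto
  have D: "(\<phi> has_real_derivative D) (at (t - A))" "0 < D"
    using desingularizing_DERIV[OF phi tA] below[of t] t by (auto simp: D_def)
  \<comment> \<open>Solves the first-order condition
    \<open>D *\<^sub>R v + (1 / R) *\<^sub>R (u - x) = 0\<close>.\<close>
  define v where "v = - (1 / (D * R)) *\<^sub>R (u - x)"
  have vn: "norm v < 1 / D"
    using nu D R by (simp add: v_def divide_simps)
  have Dv: "D * (v \<bullet> w) = - ((u - x) \<bullet> w) / R" for w
    using D by (simp add: v_def)
  have "v \<in> frechet_subdiff f u"
  proof (rule frechet_subdiffI[of f u t, OF fu])
    fix e :: real assume e: "e > 0"
    \<comment> \<open>The bound \<open>D / 2\<close> yields the a priori estimate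
      \<open>absT\<close>; the bound \<open>D\<^sup>2 * e / 8\<close> then makes the linearization
      error of \<open>\<phi>\<close> at most half of \<open>D * e * w\<close>.\<close>
    define e' where "e' = min (D / 2) (D\<^sup>2 * e / 8)"
    have e': "e' > 0" "e' \<le> D / 2" "e' \<le> D\<^sup>2 * e / 8" using D e by (auto simp: e'_def)
    have "(\<phi> has_derivative (\<lambda>h. h * D)) (at (t - A))"
      using D(1) by (simp add: has_field_derivative_def mult_commute_abs)
    then obtain r where r: "r > 0" and rr: "\<And>z. norm (z - (t - A)) < r \<Longrightarrow>
         norm (\<phi> z - \<phi> (t - A) - (z - (t - A)) * D) \<le> e' * norm (z - (t - A))"
      using e'(1) unfolding has_derivative_at_alt by blast
    have "f u \<le> Liminf (at u) f" using lsc by (simp add: lsc_def)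
    \<comment> \<open>Lower semicontinuity excludes values of \<open>f\<close> so far below
      \<open>t\<close> that the expansion \<open>rr\<close> of \<open>\<phi>\<close> does not
      apply.\<close>
    then have "\<forall>\<^sub>F y in at u. ereal (t - r) < f y"
      using r fu by (metis add_less_cancel_left diff_add_cancel diff_less_eq ereal_less(2) less_LiminfD
          less_add_same_cancel1 less_ereal.simps(1) order_less_le_trans)
    \<comment> \<open>In order, the entries ensure: \<open>y\<close> stays in the ball; the
      quadratic term is at most \<open>w\<close>; \<open>4 * w / D < r\<close>, the range of the
      expansion; \<open>4 * w / D < l - t\<close>, so that the value stays below \<open>l\<close>;
      the quadratic term is at most half of \<open>D * e * w\<close>.\<close>
    moreover define w0 where "w0 = Min {R - norm (u - x), 2 * R, D * r / 4, D * (l - t) / 4, D * e * R}"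
    have "0 < w0" using nu R D r tl e by (simp add: w0_def)
    then have "\<forall>\<^sub>F y in at u. dist y u < w0" by (auto simp: eventually_at)
    ultimately show "\<forall>\<^sub>F y in at u. ereal (t + v \<bullet> (y - u) - e * norm (y - u)) \<le> f y"
    proof eventually_elim
      case (elim y)
      define w where "w = norm (y - u)"
      have w: "0 \<le> w" "w < R - norm (u - x)" "w < 2 * R" "w < D * r / 4" "w < D * (l - t) / 4" "w < D * e * R"
        using elim by (auto simp: w_def w0_def dist_norm)
      have yR: "y \<in> cball x R"
        using w norm_triangle_ineq[of "y - u" "u - x"] by (simp add: w_def dist_norm norm_minus_commute)
      have vw: "\<bar>v \<bullet> (y - u)\<bar> \<le> w / D"
      proof -
        have "\<bar>v \<bullet> (y - u)\<bar> \<le> norm v * w" unfolding w_def by (rule Cauchy_Schwarz_ineq2)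
        also have "\<dots> \<le> 1 / D * w" using vn w by (intro mult_right_mono) auto
        finally show ?thesis by simp
      qed
      have wD: "0 \<le> w / D" using w D by simp
      show ?case
      \<comment> \<open>For large values of \<open>f y\<close> the subgradient inequality follows
        from \<open>vw\<close>; minimality is used for the values near \<open>t\<close>.\<close>
      proof (cases "ereal (t + 4 * w / D) \<le> f y")
        case True
        have "t + v \<bullet> (y - u) - e * w \<le> t + 4 * w / D"
        proof -
          have "0 \<le> e * w" using e w by simp
          moreover have "v \<bullet> (y - u) \<le> w / D" using vw by linarith
          moreover have "w / D \<le> 4 * w / D" using wD by simp
          ultimately show ?thesis by linarith
        qed
        then show ?thesis using True by (metis ereal_less_eq(3) order_trans w_def)
      next
        case False
        then obtain T where T: "f y = ereal T" using above[OF yR] by (cases "f y") auto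
        have T1: "T < t + 4 * w / D" "s < T" "t - r < T"
          using False above[OF yR] elim T by auto
        have w4: "4 * w / D < r" "4 * w / D < l - t" using w D by (auto simp: field_simps)
        have Tr: "\<bar>T - t\<bar> < r" and Tl: "T < l" using T1 w4 by auto
        have "(y, T) \<in> E" using yR T T1 Tl by (auto simp: E_def)
        from pmin[OF this] have m1: "\<phi> (t - A) + (norm (u - x))\<^sup>2 / (2 * R) \<le> \<phi> (T - A) + (norm (y - x))\<^sup>2 / (2 * R)"
          by (simp add: G_def ut)
        have "(norm (y - x))\<^sup>2 = (norm (u - x))\<^sup>2 + 2 * ((u - x) \<bullet> (y - u)) + w\<^sup>2"
          unfolding w_def power2_norm_eq_inner by (simp add: inner_diff_left inner_diff_right inner_commute)
        then have "(norm (y - x))\<^sup>2 / (2 * R) = (norm (u - x))\<^sup>2 / (2 * R) - D * (v \<bullet> (y - u)) + w\<^sup>2 / (2 * R)"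
          unfolding Dv using R by (simp add: field_simps)
        then have m2: "D * (v \<bullet> (y - u)) - w\<^sup>2 / (2 * R) \<le> \<phi> (T - A) - \<phi> (t - A)"
          using m1 by linarith
        have m3: "\<phi> (T - A) - \<phi> (t - A) \<le> (T - t) * D + e' * \<bar>T - t\<bar>"
          using rr[of "T - A"] Tr by simp
        have w2: "w\<^sup>2 / (2 * R) \<le> w"
        proof -
          have "w * w \<le> (2 * R) * w" using w by (intro mult_right_mono) auto
          then show ?thesis using R by (simp add: field_simps power2_eq_square)
        qed
        have vwD: "- w \<le> D * (v \<bullet> (y - u))"
        proof -
          have "D * \<bar>v \<bullet> (y - u)\<bar> \<le> w" using vw D by (simp add: field_simps)
          then show ?thesis using D by (smt (verit) mult_minus_right mult_left_mono)
        qed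
        \<comment> \<open>The lower side comes from minimality: after the linearization error, half
          of the linear decrease of \<open>\<phi>\<close> remains, and it is at most
          \<open>2 * w\<close>.\<close>
        have absT: "\<bar>T - t\<bar> \<le> 4 * w / D"
        proof (cases "T < t")
          case True
          have "e' * (t - T) \<le> D / 2 * (t - T)" using e' True by (intro mult_right_mono) auto
          then have "D * (t - T) / 2 \<le> 2 * w" using m2 m3 w2 vwD True by (simp add: algebra_simps)
          then show ?thesis using True D by (simp add: field_simps)
        qed (use T1 in simp)
        have a1: "e' * \<bar>T - t\<bar> \<le> D * e * w / 2"
        proof -
          have "e' * \<bar>T - t\<bar> \<le> (D\<^sup>2 * e / 8) * (4 * w / D)"
            using e' absT by (intro mult_mono) auto
          also have "\<dots> = D * e * w / 2" using D by (simp add: field_simps power2_eq_square)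
          finally show ?thesis .
        qed
        have a2: "w\<^sup>2 / (2 * R) \<le> D * e * w / 2"
        proof -
          have "w * w \<le> (D * e * R) * w" using w by (intro mult_right_mono) auto
          then show ?thesis using R by (simp add: field_simps power2_eq_square)
        qed
        have "D * (v \<bullet> (y - u) - e * w) \<le> D * (T - t)"
          using m2 m3 a1 a2 by (simp add: algebra_simps)
        then have "v \<bullet> (y - u) - e * w \<le> T - t" using D by simp
        then show ?thesis by (simp add: T w_def)
      qed
    qed
  qed
  then have "v \<in> limiting_subdiff f u" using frechet_subdiff_subset_limiting by blast
  then have ed: "edist 0 (limiting_subdiff f u) \<le> ereal (norm v)"
    unfolding edist_def by (metis (no_types, lifting) INF_lower diff_zero)
  have "f u < f a + \<eta>"
    using below[of t] t unfolding fu fa by (cases \<eta>) auto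
  then have "1 \<le> ereal D * edist 0 (limiting_subdiff f u)"
    using KL[of u] u sub fu fa s st by (auto simp: D_def)
  also have "\<dots> \<le> ereal D * ereal (norm v)"
    using ed D by (intro ereal_mult_left_mono) auto
  also have "\<dots> < 1" using vn D by (simp add: field_simps)
  finally show False by simp
qed

section \<open>Summing the step lengths\<close>

lemma lagged_telescope:
  fixes g :: "nat \<Rightarrow> real"
  assumes "k0 \<le> n"
  shows "(\<Sum>i=k0..<n. g i - g (i + N)) = (\<Sum>i<N. g (k0 + i)) - (\<Sum>i<N. g (n + i))"
  using assms
proof (induction n rule: dec_induct)
  case base then show ?case by simp
next
  case (step n)
  have "(\<Sum>i<N. g (n + i)) + g (n + N) = g n + (\<Sum>i<N. g (Suc n + i))"
    using sum.lessThan_Suc_shift[of "\<lambda>i. g (n + i)" N] by simp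
  then show ?case using step by (simp add: algebra_simps)
qed

text \<open>In a window of \<open>m\<close> indices, either some step is paid for by
  \<open>e\<close>, and domination carries this bound to the end of the window, or nothing is paid
  and the length halves. Summing the resulting inequality \<open>one\<close> leaves half of the sum
  to be absorbed on the left.\<close>

lemma sum_le_of_paid_or_dominating:
  fixes d e :: "nat \<Rightarrow> real" and B :: real
  assumes m: "4 * B\<^sup>2 \<le> real m" and B: "1 \<le> B"
    and d0: "\<And>k. 0 \<le> d k" and e0: "\<And>k. k0 \<le> k \<Longrightarrow> 0 \<le> e k"
    and dich: "\<And>k. k0 \<le> k \<Longrightarrow> k < n \<Longrightarrow>
       d (Suc k) \<le> e k \<or> (\<Sum>l=k+1..k+m. (d l)\<^sup>2) \<le> B * (d k)\<^sup>2"
  shows "(\<Sum>k=k0..n. d k) \<le> 2 * (\<Sum>k=k0..<k0+m. d k) + 2 * B * real m * (\<Sum>i=k0..<n. e i)"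
proof -
  have mpos: "m > 0" using m B by (smt (verit) gr0I of_nat_0 one_le_power)
  have sq: "u \<le> B * v" if "u\<^sup>2 \<le> B * v\<^sup>2" "0 \<le> v" for u v :: real
  proof (rule power2_le_imp_le)
    have "B \<le> B\<^sup>2" using B by (simp add: power2_eq_square)
    then have "B * v\<^sup>2 \<le> B\<^sup>2 * v\<^sup>2" by (simp add: mult_right_mono)
    then show "u\<^sup>2 \<le> (B * v)\<^sup>2" using that by (simp add: power_mult_distrib)
  qed (use that B in simp)
  have one: "d (p + m) \<le> d p / 2 + B * (\<Sum>j<m. e (p + j))" if p: "k0 \<le> p" "p + m \<le> n" for p
  proof (cases "\<exists>i. p \<le> i \<and> i < p + m \<and> d (Suc i) \<le> e i")
    case True
    let ?P = "\<lambda>i. p \<le> i \<and> i < p + m \<and> d (Suc i) \<le> e i"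
    \<comment> \<open>After the last paid index \<open>i\<close>, either \<open>Suc i\<close> ends
      the window or it is unpaid; then \<open>d (Suc i)\<close> dominates \<open>d (p + m)\<close>
      at the cost of the factor \<open>B\<close>.\<close>
    define i where "i = Greatest ?P"
    have i: "?P i" unfolding i_def using True
      by (rule GreatestI_ex_nat[where b = "p + m"]) auto
    have imax: "j \<le> i" if "?P j" for j
      unfolding i_def by (rule Greatest_le_nat[where b = "p + m"]) (use that in auto)
    have "d (p + m) \<le> B * e i"
    proof (cases "Suc i = p + m")
      case True
      then have "d (p + m) \<le> e i" using i by metis
      also have "\<dots> \<le> B * e i" using B e0[of i] i p by (simp add: mult_le_cancel_right1)
      finally show ?thesis .
    next
      case False
      then have lt: "Suc i < p + m" using i by linarith
      then have "\<not> d (Suc (Suc i)) \<le> e (Suc i)" using imax[of "Suc i"] i by auto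
      then have s: "(\<Sum>l=Suc i+1..Suc i+m. (d l)\<^sup>2) \<le> B * (d (Suc i))\<^sup>2"
        using dich[of "Suc i"] lt i p by auto
      have "(d (p+m))\<^sup>2 \<le> (\<Sum>l=Suc i+1..Suc i+m. (d l)\<^sup>2)"
        by (rule member_le_sum) (use lt i in auto)
      then have "d (p + m) \<le> B * d (Suc i)" using s sq d0 by (meson order_trans)
      then show ?thesis using i B by (smt (verit) mult_left_mono)
    qed
    also have "e i \<le> (\<Sum>j<m. e (p + j))"
      using member_le_sum[of "i - p" "{..<m}" "\<lambda>j. e (p + j)"] i e0 p by auto
    finally show ?thesis using d0[of p] B by (simp add: mult_left_mono)
  next
    case False
    then have non: "(\<Sum>l=i+1..i+m. (d l)\<^sup>2) \<le> B * (d i)\<^sup>2" if "p \<le> i" "i < p + m" for i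
      using dich[of i] that p by auto
    \<comment> \<open>Each \<open>d l\<close> in the window dominates \<open>d (p + m)\<close>,
      while \<open>d p\<close> dominates the whole window. Together the squares shrink by the factor
      \<open>B\<^sup>2 / m \<le> 1 / 4\<close>.\<close>
    have lb: "(d (p+m))\<^sup>2 / B \<le> (d l)\<^sup>2" if l: "l \<in> {p+1..p+m}" for l
    proof (cases "l = p + m")
      case True
      have "(d (p+m))\<^sup>2 / B \<le> (d (p+m))\<^sup>2 / 1" using B by (intro divide_left_mono) auto
      then show ?thesis using True by simp
    next
      case False
      have "(d (p+m))\<^sup>2 \<le> (\<Sum>j=l+1..l+m. (d j)\<^sup>2)"
        by (rule member_le_sum) (use l False in auto)
      also have "\<dots> \<le> B * (d l)\<^sup>2" using non[of l] l False by auto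
      finally show ?thesis using B by (simp add: field_simps)
    qed
    have "real m * ((d (p+m))\<^sup>2 / B) = (\<Sum>l=p+1..p+m. (d (p+m))\<^sup>2 / B)" by simp
    also have "\<dots> \<le> (\<Sum>l=p+1..p+m. (d l)\<^sup>2)" by (rule sum_mono) (rule lb)
    also have "\<dots> \<le> B * (d p)\<^sup>2" using non[of p] mpos by simp
    finally have A: "real m * (d (p+m))\<^sup>2 \<le> B\<^sup>2 * (d p)\<^sup>2"
      using B by (simp add: field_simps power2_eq_square)
    have "4 * B\<^sup>2 * (d (p+m))\<^sup>2 \<le> real m * (d (p+m))\<^sup>2"
      using m by (simp add: mult_right_mono)
    then have "B\<^sup>2 * (4 * (d (p+m))\<^sup>2) \<le> B\<^sup>2 * (d p)\<^sup>2" using A by simp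
    then have "4 * (d (p+m))\<^sup>2 \<le> (d p)\<^sup>2" using B by simp
    then have "(d (p+m))\<^sup>2 \<le> (d p / 2)\<^sup>2" by (simp add: power_divide)
    then have "d (p + m) \<le> d p / 2" using d0[of p] power2_le_imp_le[of "d (p + m)" "d p / 2"] by simp
    moreover have "0 \<le> (\<Sum>j<m. e (p + j))" using e0 p by (intro sum_nonneg) auto
    ultimately show ?thesis using B by (smt (verit) mult_nonneg_nonneg)
  qed
  have dsum: "(\<Sum>k=k0..n. d k) \<le> (\<Sum>k=k0..<k0+m. d k) + (\<Sum>k=k0+m..n. d k)"
    using d0 by (subst sum.union_disjoint[symmetric]) (auto intro!: sum_mono2)
  have esum0: "0 \<le> (\<Sum>i=k0..<n. e i)" using e0 by (intro sum_nonneg) auto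
  have "(\<Sum>k=k0+m..n. d k) \<le> (\<Sum>k=k0..n. d k) / 2 + B * real m * (\<Sum>i=k0..<n. e i)"
  proof (cases "k0 + m \<le> n")
    case True
    then obtain q where n: "n = q + m" and q: "k0 \<le> q" by (metis add_le_cancel_right le_Suc_ex le_add2 add.commute add_leE le_add_diff_inverse2)
    have "(\<Sum>k=k0+m..n. d k) = (\<Sum>p=k0..q. d (p + m))"
      unfolding n by (rule sum.shift_bounds_cl_nat_ivl)
    also have "\<dots> \<le> (\<Sum>p=k0..q. d p / 2 + B * (\<Sum>j<m. e (p + j)))"
      by (rule sum_mono) (use one n in auto)
    also have "\<dots> = (\<Sum>p=k0..q. d p) / 2 + B * (\<Sum>j<m. \<Sum>p=k0..q. e (p + j))"
      by (simp add: sum.distrib sum_divide_distrib sum_distrib_left sum.swap[of _ "{..<m}"])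
    also have "(\<Sum>p=k0..q. d p) \<le> (\<Sum>k=k0..n. d k)"
      using d0 n by (intro sum_mono2) auto
    \<comment> \<open>For each offset \<open>j\<close> a payment is counted at most once, hence at
      most \<open>m\<close> times in all.\<close>
    also have "(\<Sum>j<m. \<Sum>p=k0..q. e (p + j)) \<le> (\<Sum>j<m. \<Sum>i=k0..<n. e i)"
    proof (rule sum_mono)
      fix j assume j: "j \<in> {..<m}"
      have "(\<Sum>p=k0..q. e (p + j)) = (\<Sum>i=k0+j..q+j. e i)"
        by (rule sum.shift_bounds_cl_nat_ivl[symmetric])
      also have "\<dots> \<le> (\<Sum>i=k0..<n. e i)" using j n e0 by (intro sum_mono2) auto
      finally show "(\<Sum>p=k0..q. e (p + j)) \<le> (\<Sum>i=k0..<n. e i)" .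
    qed
    finally show ?thesis using B by (simp add: mult_left_mono mult.assoc)
  next
    case False
    have "0 \<le> (\<Sum>k=k0..n. d k)" using d0 by (intro sum_nonneg) auto
    then show ?thesis using False esum0 B by simp
  qed
  then show ?thesis using dsum by simp
qed

section \<open>Convergence to a cluster point with the KL property\<close>

lemma square_decrease_tendsto_0:
  fixes d \<Psi> :: "nat \<Rightarrow> real"
  assumes "\<Psi> \<longlonglongrightarrow> A" and a: "0 < a" and d0: "\<And>k. 0 \<le> d k"
    and dec: "\<And>k. K \<le> k \<Longrightarrow> \<Psi> (Suc k) + a * (d k)\<^sup>2 \<le> \<Psi> k"
  shows "d \<longlonglongrightarrow> 0"
proof -
  have "(\<lambda>k. (\<Psi> k - \<Psi> (Suc k)) / a) \<longlonglongrightarrow> (A - A) / a"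
    by (intro tendsto_intros assms(1) LIMSEQ_Suc) (use a in auto)
  then have z: "(\<lambda>k. (\<Psi> k - \<Psi> (Suc k)) / a) \<longlonglongrightarrow> 0" by simp
  have "(\<lambda>k. (d k)\<^sup>2) \<longlonglongrightarrow> 0"
  proof (rule tendsto_sandwich[OF _ _ tendsto_const z])
    show "\<forall>\<^sub>F k in sequentially. (d k)\<^sup>2 \<le> (\<Psi> k - \<Psi> (Suc k)) / a"
      using dec a by (auto simp: field_simps eventually_sequentially intro!: exI[of _ K])
  qed simp
  then have "(\<lambda>k. sqrt ((d k)\<^sup>2)) \<longlonglongrightarrow> sqrt 0" by (rule tendsto_real_sqrt)
  then show ?thesis using d0 by simp
qed

text \<open>Separates the metric argument from the algorithm. \<open>grow\<close> keeps
  \<open>F\<close> near \<open>x k\<close> above \<open>\<Psi> (Suc k) - b * (d k)\<^sup>2\<close>;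
  comparing this level with the value of \<open>\<Psi>\<close> after \<open>m\<close> further steps
  gives the dichotomy \<open>dich\<close>, which bounds the length of the path near
  \<open>xb\<close>.\<close>

lemma converges_to_KL_cluster_point:
  fixes F :: "'a::euclidean_space \<Rightarrow> ereal" and x :: "nat \<Rightarrow> 'a" and d r \<Psi> :: "nat \<Rightarrow> real"
  assumes d_def: "\<And>k. d k = norm (x k - x (k - 1))"
    and lsc: "lsc F" and proper: "\<And>u. F u \<noteq> -\<infinity>" and KL: "KL_at F xb" and Fxb: "F xb = ereal A"
    and val: "\<And>k. K \<le> k \<Longrightarrow> F (x k) = ereal (r k)" and r\<Psi>: "\<And>k. K \<le> k \<Longrightarrow> r k \<le> \<Psi> k"
    and a: "0 < a" "a \<le> C" and b: "0 \<le> b"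
    and dec: "\<And>k. K \<le> k \<Longrightarrow> \<Psi> (Suc k) + a * (d k)\<^sup>2 \<le> \<Psi> k" and lim: "\<Psi> \<longlonglongrightarrow> A"
    and grow: "\<And>k u c. K \<le> k \<Longrightarrow> norm (u - x k) \<le> 1 \<Longrightarrow> F u = ereal c \<Longrightarrow>
        \<Psi> (Suc k) + a * ((d (Suc k))\<^sup>2 + (d k)\<^sup>2) \<le> c + b * (d k)\<^sup>2
          + C * (norm (u - x k))\<^sup>2 + C * norm (u - x k) * (d (Suc k) + d k)"
    and cluster: "strict_mono s" "(x \<circ> s) \<longlonglongrightarrow> xb"
  shows "x \<longlonglongrightarrow> xb"
proof -
  obtain \<eta> U \<phi> where \<eta>: "0 < \<eta>" and U: "open U" "xb \<in> U" and phi: "\<phi> \<in> desingularizing \<eta>"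
    and KLU: "\<And>u. u \<in> U \<Longrightarrow> F xb < F u \<Longrightarrow> F u < F xb + \<eta> \<Longrightarrow>
        1 \<le> ereal (deriv \<phi> (real_of_ereal (F u - F xb))) * edist 0 (limiting_subdiff F u)"
    using KL unfolding KL_at_def by blast
  obtain \<rho>U where \<rho>U: "\<rho>U > 0" "cball xb \<rho>U \<subseteq> U" using U by (meson open_contains_cball)
  have d0: "0 \<le> d k" for k by (simp add: d_def)
  define V where "V k = \<Psi> k - A" for k
  have dec1: "\<Psi> (Suc k) \<le> \<Psi> k" if "K \<le> k" for k
    using dec[OF that] a by (smt (verit) mult_nonneg_nonneg zero_le_power2)
  have mono\<Psi>: "\<Psi> j \<le> \<Psi> k" if "K \<le> k" "k \<le> j" for k j
    using that(2,1) by (induction j rule: dec_induct) (auto intro: order_trans[OF dec1])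
  have V0: "0 \<le> V k" if "K \<le> k" for k
    using LIMSEQ_le_const2[OF lim, of "\<Psi> k"] mono\<Psi>[OF that] by (auto simp: V_def)
  have monoV: "V j \<le> V k" if "K \<le> k" "k \<le> j" for k j
    using mono\<Psi>[OF that] by (simp add: V_def)
  have limV: "V \<longlonglongrightarrow> 0" unfolding V_def using tendsto_diff[OF lim tendsto_const, of A] by simp
  have limd: "d \<longlonglongrightarrow> 0"
    by (rule square_decrease_tendsto_0[OF lim a(1) d0 dec])
  have lim\<phi>: "(\<lambda>k. \<phi> (V k)) \<longlonglongrightarrow> 0"
  proof -
    have c: "continuous_on {s. 0 \<le> s \<and> ereal s < \<eta>} \<phi>" and p0: "\<phi> 0 = 0"
      using phi by (auto simp: desingularizing_def)
    have "\<forall>\<^sub>F k in sequentially. ereal (V k) < \<eta>"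
      using \<eta> limV by (intro order_tendstoD(2)[of _ 0]) (auto simp: zero_ereal_def)
    moreover have "\<forall>\<^sub>F k in sequentially. 0 \<le> V k" using V0 by (auto simp: eventually_sequentially)
    ultimately have "\<forall>\<^sub>F k in sequentially. V k \<in> {s. 0 \<le> s \<and> ereal s < \<eta>}"
      by eventually_elim simp
    then have "(\<lambda>k. \<phi> (V k)) \<longlonglongrightarrow> \<phi> 0"
      using \<eta> by (intro continuous_on_tendsto_compose[OF c limV]) (auto simp: zero_ereal_def)
    then show ?thesis by (simp add: p0)
  qed
  \<comment> \<open>With this ratio the last two terms of \<open>grow\<close> are at most
    \<open>7/16 * a * (d (Suc k))\<^sup>2 + 1/8 * a * (d k)\<^sup>2\<close>, strictly less than the
    decrease on its left-hand side.\<close>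
  define \<kappa> where "\<kappa> = a / (4 * C)"
  have C: "0 < C" using a by simp
  have \<kappa>: "0 < \<kappa>" "\<kappa> \<le> 1 / 4" "C * \<kappa> = a / 4" using a by (auto simp: \<kappa>_def field_simps)
  have lower: "\<Psi> (Suc k) - b * (d k)\<^sup>2 < c"
    if k: "K \<le> k" and u: "norm (u - x k) \<le> \<kappa> * d (Suc k)" "norm (u - x k) \<le> 1" "F u = ereal c" and p: "0 < d (Suc k)" for k u c
  proof -
    let ?n = "norm (u - x k)" and ?d = "d (Suc k)"
    have "C * ?n\<^sup>2 \<le> C * (\<kappa> * ?d)\<^sup>2" using u C by (intro mult_left_mono power_mono) auto
    also have "\<dots> = (C * \<kappa>) * \<kappa> * ?d\<^sup>2" by (simp add: power2_eq_square)
    also have "\<dots> \<le> a / 4 * (1 / 4) * ?d\<^sup>2" unfolding \<kappa>(3) using \<kappa> a by (intro mult_right_mono mult_left_mono) auto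
    finally have 1: "C * ?n\<^sup>2 \<le> a / 16 * ?d\<^sup>2" by simp
    have "C * ?n * (?d + d k) \<le> C * (\<kappa> * ?d) * (?d + d k)"
      using u C d0[of k] p by (intro mult_left_mono mult_right_mono) auto
    also have "\<dots> = (C * \<kappa>) * (?d\<^sup>2 + ?d * d k)" by (simp add: algebra_simps power2_eq_square)
    also have "\<dots> = a / 4 * (?d\<^sup>2 + ?d * d k)" unfolding \<kappa>(3) ..
    also have "\<dots> \<le> a / 4 * (?d\<^sup>2 + (?d\<^sup>2 + (d k)\<^sup>2) / 2)"
      using sum_squares_bound[of ?d "d k"] a by (intro mult_left_mono) auto
    finally have 2: "C * ?n * (?d + d k) \<le> a * (3 / 8) * ?d\<^sup>2 + a / 8 * (d k)\<^sup>2" by (simp add: algebra_simps add_divide_distrib)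
    have "0 < a * ?d\<^sup>2" "0 \<le> a * (d k)\<^sup>2" using a p by auto
    then show ?thesis using grow[OF k u(2,3)] 1 2 by (simp add: algebra_simps)
  qed
  \<comment> \<open>If \<open>\<Psi>\<close> drops by less than \<open>b * (d k)\<^sup>2\<close> in
    \<open>m\<close> steps, \<open>tel\<close> gives domination with factor \<open>b / a\<close>;
    the summation lemma asks for a factor of at least \<open>1\<close>.\<close>
  define B where "B = max 1 (b / a)"
  have B: "1 \<le> B" "b \<le> B * a" using a by (auto simp: B_def field_simps max_def)
  obtain m :: nat where m: "4 * B\<^sup>2 \<le> real m" using real_arch_simple by blast
  have tel: "(\<Sum>l=k+1..k+j. a * (d l)\<^sup>2) \<le> \<Psi> (Suc k) - \<Psi> (Suc (k + j))" if "K \<le> k" for k j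
  proof (induction j)
    case (Suc j)
    then show ?case using dec[of "Suc (k + j)"] that by simp
  qed simp
  obtain k1 where k1: "K \<le> k1" and k1V: "ereal (V k1) < \<eta>"
  proof -
    have "\<forall>\<^sub>F k in sequentially. ereal (V k) < \<eta>"
      using \<eta> limV by (intro order_tendstoD(2)[of _ 0]) (auto simp: zero_ereal_def)
    then obtain N where "\<And>k. N \<le> k \<Longrightarrow> ereal (V k) < \<eta>" by (auto simp: eventually_sequentially)
    then show ?thesis using that[of "max N K"] by simp
  qed
  have V\<eta>: "ereal (V k) < \<eta>" if "k1 \<le> k" for k
    using monoV[OF k1 that] k1V by (metis ereal_less_eq(3) order_le_less_trans)
  have \<phi>mono: "\<phi> (V j) \<le> \<phi> (V k)" if "k1 \<le> k" "k \<le> j" for k j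
    by (rule desingularizing_mono[OF phi]) (use V\<eta> monoV V0 that k1 in auto)
  have \<phi>0: "0 \<le> \<phi> (V k)" if "k1 \<le> k" for k
    using phi V\<eta>[OF that] V0[of k] that k1 by (auto simp: desingularizing_def)
  \<comment> \<open>\<open>2 / \<kappa>\<close> inverts the left-hand side
    \<open>\<kappa> * d (Suc k) / 2\<close> of the error bound. The lag is \<open>Suc m\<close>
    because \<open>\<Psi> k\<close> is compared with the level
    \<open>\<Psi> (Suc (k + m))\<close>.\<close>
  define e where "e k = 2 / \<kappa> * (\<phi> (V k) - \<phi> (V (k + Suc m)))" for k
  have e0: "0 \<le> e k" if "k1 \<le> k" for k
    using \<phi>mono[OF that, of "k + Suc m"] \<kappa> by (simp add: e_def)
  have dich: "d (Suc k) \<le> e k \<or> (\<Sum>l=k+1..k+m. (d l)\<^sup>2) \<le> B * (d k)\<^sup>2"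
    if k: "k1 \<le> k" and near: "cball (x k) (d (Suc k)) \<subseteq> U" and d1: "d (Suc k) \<le> 1" for k
  proof (cases "\<Psi> (Suc (k + m)) \<le> \<Psi> (Suc k) - b * (d k)\<^sup>2")
    case True
    have kK: "K \<le> k" using k k1 by simp
    show ?thesis
    proof (cases "d (Suc k) = 0")
      case True then show ?thesis using e0[OF k] by simp
    next
      case False
      then have p: "0 < d (Suc k)" using d0[of "Suc k"] by simp
      let ?R = "\<kappa> * d (Suc k)" and ?s = "\<Psi> (Suc (k + m))"
      have R: "0 < ?R" "?R \<le> d (Suc k)" using \<kappa> p by (auto simp: mult_le_cancel_right1)
      have rV: "r k - A \<le> V k" using r\<Psi>[OF kK] by (simp add: V_def)
      have above: "ereal ?s < F u" if u: "u \<in> cball (x k) ?R" for u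
      proof -
        have n: "norm (u - x k) \<le> ?R" using u by (simp add: dist_norm norm_minus_commute)
        show ?thesis
        proof (cases "F u")
          case (real c)
          then show ?thesis using lower[OF kK n _ real p] n R d1 True by simp
        next
          case MInf
          then show ?thesis using proper by simp
        qed simp
      qed
      have "?R / 2 \<le> \<phi> (r k - A) - \<phi> (?s - A)"
      proof (rule KL_error_bound[OF lsc phi Fxb KLU R(1) _ val[OF kK]])
        show "cball (x k) ?R \<subseteq> U" using near R(2) by (meson cball_subset_cball_iff dual_order.trans subset_cball)
        show "ereal (r k - A) < \<eta>" using rV V\<eta>[OF k] by (metis ereal_less_eq(3) order_le_less_trans)
        show "A \<le> ?s" using V0[of "Suc (k + m)"] kK by (simp add: V_def)
      qed (use above in auto)
      also have "\<phi> (r k - A) \<le> \<phi> (V k)"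
      proof (rule desingularizing_mono[OF phi _ rV V\<eta>[OF k]])
        \<comment> \<open>\<open>r k\<close> is only known to be at most \<open>\<Psi> k\<close> and
          might lie below \<open>A\<close>; the lower bound at the center of the ball excludes
          this.\<close>
        have "ereal ?s < ereal (r k)" using above[of "x k"] R val[OF kK] by simp
        then show "0 \<le> r k - A" using V0[of "Suc (k + m)"] kK by (simp add: V_def)
      qed
      finally have "d (Suc k) \<le> e k" using \<kappa> by (simp add: e_def V_def field_simps)
      then show ?thesis ..
    qed
  next
    case False
    have "a * (\<Sum>l=k+1..k+m. (d l)\<^sup>2) \<le> \<Psi> (Suc k) - \<Psi> (Suc (k + m))"
      using tel[of k m] k k1 by (simp add: sum_distrib_left)
    also have "\<dots> \<le> b * (d k)\<^sup>2" using False by simp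
    also have "\<dots> \<le> B * a * (d k)\<^sup>2" using B by (intro mult_right_mono) auto
    finally have "a * (\<Sum>l=k+1..k+m. (d l)\<^sup>2) \<le> a * (B * (d k)\<^sup>2)" by (simp add: mult_ac)
    then show ?thesis using a by simp
  qed
  \<comment> \<open>Start at a subsequence point near \<open>xb\<close> where steps and
    \<open>\<phi> (V k)\<close> are small. While the iterates stay within \<open>\<rho>\<close>, the
    path has length at most \<open>\<rho> / 2\<close>, so they cannot leave. With
    \<open>2 * \<rho> \<le> \<rho>U\<close> the balls of radius
    \<open>d (Suc k) \<le> \<rho>\<close> about them lie in \<open>U\<close>.\<close>
  have trap: "\<forall>\<^sub>F n in sequentially. dist (x n) xb \<le> \<rho>" if \<rho>: "0 < \<rho>" "2 * \<rho> \<le> \<rho>U" for \<rho>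
  proof -
    define \<theta> where "\<theta> = \<rho> / (8 * (real m + 1))"
    have \<theta>: "0 < \<theta>" using \<rho> by (simp add: \<theta>_def)
    define Q where "Q = 2 * B * real m * (2 / \<kappa> * real (Suc m))"
    have Q: "0 \<le> Q" using B \<kappa> by (simp add: Q_def)
    have "\<forall>\<^sub>F k in sequentially. d k < min \<theta> (min 1 \<rho>)"
      using limd \<theta> \<rho> by (intro order_tendstoD(2)[of d 0]) auto
    moreover have "\<forall>\<^sub>F k in sequentially. Q * \<phi> (V k) < \<rho> / 4"
      using tendsto_mult_right_zero[OF lim\<phi>, of Q] \<rho> by (intro order_tendstoD(2)[of _ 0]) auto
    ultimately have "\<forall>\<^sub>F k in sequentially. d k < min \<theta> (min 1 \<rho>) \<and> Q * \<phi> (V k) < \<rho> / 4"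
      by eventually_elim simp
    then obtain k2 where k2: "\<And>k. k2 \<le> k \<Longrightarrow> d k < min \<theta> (min 1 \<rho>) \<and> Q * \<phi> (V k) < \<rho> / 4"
      by (auto simp: eventually_sequentially)
    have "\<forall>\<^sub>F j in sequentially. dist (x (s j)) xb < \<rho> / 4"
      using tendstoD[OF cluster(2), of "\<rho> / 4"] \<rho> by (simp add: o_def)
    moreover have "\<forall>\<^sub>F j in sequentially. max k1 k2 \<le> s j"
      using filterlim_subseq[OF cluster(1)] unfolding filterlim_at_top by blast
    ultimately have "\<forall>\<^sub>F j in sequentially. dist (x (s j)) xb < \<rho> / 4 \<and> max k1 k2 \<le> s j"
      by eventually_elim simp
    then obtain k0 where k0: "dist (x k0) xb < \<rho> / 4" "k1 \<le> k0" "k2 \<le> k0"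
      by (auto simp: eventually_sequentially)
    have small: "d k < \<theta>" "d k \<le> 1" "d k \<le> \<rho>" if "k0 \<le> k" for k using k2[of k] that k0 by auto
    have tot: "2 * (\<Sum>k=k0..<k0+m. d k) + 2 * B * real m * (\<Sum>i=k0..<n. e i) \<le> \<rho> / 2"
      if n: "k0 \<le> n" for n
    proof -
      have "(\<Sum>k=k0..<k0+m. d k) \<le> (\<Sum>k=k0..<k0+m. \<theta>)"
        using small by (intro sum_mono) (auto intro: less_imp_le)
      also have "\<dots> = real m * \<theta>" by simp
      also have "\<dots> \<le> \<rho> / 8" using \<rho> by (simp add: \<theta>_def field_simps)
      finally have 1: "2 * (\<Sum>k=k0..<k0+m. d k) \<le> \<rho> / 4" by simp
      \<comment> \<open>At most the first \<open>Suc m\<close> values of \<open>\<phi>\<close>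
        survive, so the bound is independent of \<open>n\<close>.\<close>
      have "(\<Sum>i=k0..<n. \<phi> (V i) - \<phi> (V (i + Suc m))) =
          (\<Sum>i<Suc m. \<phi> (V (k0 + i))) - (\<Sum>i<Suc m. \<phi> (V (n + i)))"
        by (rule lagged_telescope[OF n, of "\<lambda>i. \<phi> (V i)" "Suc m"])
      also have "\<dots> \<le> (\<Sum>i<Suc m. \<phi> (V (k0 + i)))"
        using n k0 \<phi>0 by (simp del: sum.lessThan_Suc add: sum_nonneg)
      also have "\<dots> \<le> (\<Sum>i<Suc m. \<phi> (V k0))" using \<phi>mono[OF k0(2)] by (intro sum_mono) simp
      also have "\<dots> = real (Suc m) * \<phi> (V k0)" by simp
      finally have "(\<Sum>i=k0..<n. e i) \<le> 2 / \<kappa> * (real (Suc m) * \<phi> (V k0))"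
        unfolding e_def sum_distrib_left[symmetric] using \<kappa> by (intro mult_left_mono) auto
      then have "2 * B * real m * (\<Sum>i=k0..<n. e i) \<le> 2 * B * real m * (2 / \<kappa> * (real (Suc m) * \<phi> (V k0)))"
        using B by (intro mult_left_mono) auto
      also have "\<dots> = Q * \<phi> (V k0)" by (simp add: Q_def)
      also have "\<dots> \<le> \<rho> / 4" using k2[OF k0(3)] by simp
      finally show ?thesis using 1 by simp
    qed
    \<comment> \<open>The length up to \<open>n\<close> uses the dichotomy for \<open>k < n\<close>,
      hence only the location of earlier iterates; this is what makes the strong induction
      work.\<close>
    have step: "dist (x n) xb \<le> \<rho>"
      if n: "k0 \<le> n" and prev: "\<And>k. k0 \<le> k \<Longrightarrow> k < n \<Longrightarrow> dist (x k) xb \<le> \<rho>" for n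
    proof -
      have "(\<Sum>k=k0..n. d k) \<le> 2 * (\<Sum>k=k0..<k0+m. d k) + 2 * B * real m * (\<Sum>i=k0..<n. e i)"
      proof (rule sum_le_of_paid_or_dominating[OF m B(1) d0])
        show "0 \<le> e k" if "k0 \<le> k" for k using e0 that k0 by simp
        fix k assume k: "k0 \<le> k" "k < n"
        have "cball (x k) (d (Suc k)) \<subseteq> cball xb \<rho>U"
        proof
          fix u assume "u \<in> cball (x k) (d (Suc k))"
          then have "dist xb u \<le> \<rho> + \<rho>"
            using dist_triangle[of xb u "x k"] prev[OF k] small(3)[of "Suc k"] k by (simp add: dist_commute)
          then show "u \<in> cball xb \<rho>U" using \<rho> by simp
        qed
        then show "d (Suc k) \<le> e k \<or> (\<Sum>l=k+1..k+m. (d l)\<^sup>2) \<le> B * (d k)\<^sup>2"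
          using dich[of k] k k0 \<rho>U small(2)[of "Suc k"] by auto
      qed
      then have sum: "(\<Sum>k=k0..n. d k) \<le> \<rho> / 2" using tot[OF n] by simp
      have "norm (x n - x k0) \<le> (\<Sum>k=k0..n. d k)"
        using n
      proof (induction n rule: dec_induct)
        case base then show ?case using d0 by simp
      next
        case (step j)
        have "norm (x (Suc j) - x k0) \<le> norm (x (Suc j) - x j) + norm (x j - x k0)"
          using norm_triangle_ineq[of "x (Suc j) - x j" "x j - x k0"] by simp
        then show ?case using step by (simp add: d_def)
      qed
      then show ?thesis using sum k0 \<rho> dist_triangle[of "x n" xb "x k0"] by (simp add: dist_norm)
    qed
    have "dist (x n) xb \<le> \<rho>" if "k0 \<le> n" for n
      using that by (induction n rule: less_induct) (auto intro: step)
    then show ?thesis by (auto simp: eventually_sequentially)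
  qed
  show ?thesis
  proof (rule tendstoI)
    fix \<epsilon> :: real assume "0 < \<epsilon>"
    then have "\<forall>\<^sub>F n in sequentially. dist (x n) xb \<le> min (\<rho>U / 2) (\<epsilon> / 2)"
      using \<rho>U by (intro trap) auto
    then show "\<forall>\<^sub>F n in sequentially. dist (x n) xb < \<epsilon>"
      using \<open>0 < \<epsilon>\<close> by (auto elim!: eventually_mono)
  qed
qed

section \<open>Estimates for one proximal gradient step\<close>

text \<open>The descent lemma in both directions: \<open>\<psi>\<close> has nonpositive derivative
  along the segment, for either sign \<open>\<sigma>\<close>.\<close>

lemma lipschitz_gradient_quadratic_bound:
  fixes h :: "'a::euclidean_space \<Rightarrow> real"
  assumes g: "\<And>u. GDERIV h u :> g u" and L: "L-lipschitz_on UNIV g"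
  shows "\<bar>h y - h x - g x \<bullet> (y - x)\<bar> \<le> L / 2 * (norm (y - x))\<^sup>2"
proof -
  define w where "w = y - x"
  have one: "\<sigma> * (h y - h x - g x \<bullet> w) \<le> L / 2 * (norm w)\<^sup>2" if \<sigma>: "\<bar>\<sigma>\<bar> = 1" for \<sigma> :: real
  proof -
    define \<psi> where "\<psi> = (\<lambda>t. \<sigma> * (h (x + t *\<^sub>R w) - t * (g x \<bullet> w)) - L / 2 * t\<^sup>2 * (norm w)\<^sup>2)"
    have p: "((\<lambda>t. h (x + t *\<^sub>R w)) has_real_derivative g (x + t *\<^sub>R w) \<bullet> w) (at t)" for t
    proof -
      have "((\<lambda>t. x + t *\<^sub>R w) has_derivative (\<lambda>s. s *\<^sub>R w)) (at t)"
        by (auto intro!: derivative_eq_intros)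
      from has_derivative_compose[OF this g[unfolded gderiv_def]]
      show ?thesis by (simp add: has_field_derivative_def inner_commute mult.commute[of "w \<bullet> _"] mult_commute_abs)
    qed
    have "\<psi> 1 \<le> \<psi> 0"
    proof (rule DERIV_nonpos_imp_nonincreasing[of 0 1 \<psi>])
      fix t :: real assume t: "0 \<le> t" "t \<le> 1"
      have "(\<psi> has_real_derivative
          \<sigma> * (g (x + t *\<^sub>R w) \<bullet> w - g x \<bullet> w) - L * t * (norm w)\<^sup>2) (at t)"
        unfolding \<psi>_def by (rule derivative_eq_intros p refl | simp)+
      moreover have "\<sigma> * (g (x + t *\<^sub>R w) \<bullet> w - g x \<bullet> w) \<le> L * t * (norm w)\<^sup>2"
      proof -
        have "\<sigma> * (g (x + t *\<^sub>R w) \<bullet> w - g x \<bullet> w) \<le> \<bar>\<sigma> * (g (x + t *\<^sub>R w) \<bullet> w - g x \<bullet> w)\<bar>" by simp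
        also have "\<dots> = \<bar>(g (x + t *\<^sub>R w) - g x) \<bullet> w\<bar>"
          using \<sigma> by (simp add: abs_mult inner_diff_left)
        also have "\<dots> \<le> norm (g (x + t *\<^sub>R w) - g x) * norm w" by (rule Cauchy_Schwarz_ineq2)
        also have "\<dots> \<le> (L * norm (t *\<^sub>R w)) * norm w"
          using lipschitz_onD[OF L, of "x + t *\<^sub>R w" x] by (intro mult_right_mono) (auto simp: dist_norm)
        also have "\<dots> = L * t * (norm w)\<^sup>2" using t by (simp add: power2_eq_square)
        finally show ?thesis .
      qed
      ultimately show "\<exists>y. (\<psi> has_real_derivative y) (at t) \<and> y \<le> 0"
        by (metis diff_le_0_iff_le)
    qed simp
    then show ?thesis by (simp add: \<psi>_def w_def algebra_simps)
  qed
  show ?thesis using one[of 1] one[of "-1"] by (simp add: w_def abs_if)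
qed

lemma prox_finite:
  assumes "proper f" "xp \<in> prox \<tau> f p"
  obtains r where "f xp = ereal r"
proof -
  obtain u where u: "f u \<noteq> \<infinity>" using assms by (auto simp: proper_def)
  have "f xp + ereal (\<tau> / 2 * (norm (xp - p))\<^sup>2) \<le> f u + ereal (\<tau> / 2 * (norm (u - p))\<^sup>2)"
    using assms by (auto simp: prox_def is_arg_min_def not_less)
  then have "f xp \<noteq> \<infinity>" using u by auto
  moreover have "f xp \<noteq> -\<infinity>" using assms by (auto simp: proper_def)
  ultimately show ?thesis using that by (cases "f xp") auto
qed

text \<open>Completing the square turns the shift by \<open>(1 / \<tau>) *\<^sub>R g\<close> into a
  linear term; the remaining constant is the same on both sides.\<close>

lemma prox_inequality:
  assumes xp: "xp \<in> prox \<tau> f (y - (1 / \<tau>) *\<^sub>R g)" and \<tau>: "\<tau> > 0"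
    and fin: "f xp = ereal a" "f q = ereal b"
  shows "a + g \<bullet> xp + \<tau> / 2 * (norm (xp - y))\<^sup>2 \<le> b + g \<bullet> q + \<tau> / 2 * (norm (q - y))\<^sup>2"
proof -
  have ex: "\<tau> / 2 * (norm (u - (y - (1 / \<tau>) *\<^sub>R g)))\<^sup>2
      = g \<bullet> u + \<tau> / 2 * (norm (u - y))\<^sup>2 + ((norm g)\<^sup>2 / (2 * \<tau>) - g \<bullet> y)" for u
  proof -
    have sq: "(norm (p + (1 / \<tau>) *\<^sub>R g))\<^sup>2 = (norm p)\<^sup>2 + 2 / \<tau> * (g \<bullet> p) + (norm g)\<^sup>2 / \<tau>\<^sup>2" for p
      unfolding power2_norm_eq_inner
      by (simp add: inner_add_left inner_add_right inner_commute[of p g] power2_eq_square add_divide_distrib)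
    have "(norm (u - (y - (1 / \<tau>) *\<^sub>R g)))\<^sup>2
       = (norm (u - y))\<^sup>2 + 2 / \<tau> * (g \<bullet> (u - y)) + (norm g)\<^sup>2 / \<tau>\<^sup>2"
      using sq[of "u - y"] by (simp add: algebra_simps)
    then show ?thesis using \<tau> by (simp add: field_simps power2_eq_square inner_diff_right)
  qed
  have "f xp + ereal (\<tau> / 2 * (norm (xp - (y - (1 / \<tau>) *\<^sub>R g)))\<^sup>2)
      \<le> f q + ereal (\<tau> / 2 * (norm (q - (y - (1 / \<tau>) *\<^sub>R g)))\<^sup>2)"
    using xp by (auto simp: prox_def is_arg_min_def not_less)
  then show ?thesis unfolding ex fin by simp
qed

text \<open>Minimality is tested against an arbitrary \<open>q\<close>, and \<open>h\<close> is
  bounded by its linearization at \<open>x\<close>, from above at \<open>xp\<close> and from below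
  at \<open>q\<close>. The extrapolations cost cross terms with coefficient
  \<open>\<kappa> = \<alpha> * \<tau> + \<beta> * L\<close>. The step rule says
  \<open>\<tau> = L + \<kappa> + (1 + \<epsilon>) * \<delta>\<close>, and the condition on
  \<open>\<delta>\<close> gives \<open>\<kappa> \<le> (1 - \<epsilon>) * \<delta>\<close>; this
  leaves the surplus \<open>\<epsilon> * \<delta> / 2\<close> on both squares.\<close>

lemma inertial_prox_estimate:
  fixes h :: "'a::euclidean_space \<Rightarrow> real"
  assumes g: "\<And>u. GDERIV h u :> g u" and L: "L-lipschitz_on UNIV g"
    and xp: "xp \<in> prox \<tau> f (x + \<alpha> *\<^sub>R D - (1 / \<tau>) *\<^sub>R g (x + \<beta> *\<^sub>R D))"
    and \<tau>: "\<tau> > 0" "\<tau> * (1 - \<alpha>) = (1 + \<epsilon>) * \<delta> + (1 + \<beta>) * L"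
    and par: "0 \<le> \<alpha>" "\<alpha> < 1" "0 \<le> \<beta>" "0 \<le> \<epsilon>" "0 \<le> \<delta>" "2 * \<alpha> * \<delta> + (\<alpha> + \<beta>) * L \<le> (1 - \<epsilon>) * \<delta>"
    and fin: "f xp = ereal a" "f q = ereal b"
  shows "a + h xp + \<delta> / 2 * (norm (xp - x))\<^sup>2 + \<epsilon> * \<delta> / 2 * ((norm (xp - x))\<^sup>2 + (norm D)\<^sup>2)
     \<le> b + h q + \<delta> / 2 * (norm D)\<^sup>2 + (L + \<tau>) / 2 * (norm (q - x))\<^sup>2 + \<delta> * norm (q - x) * norm D"
proof -
  define d where "d = xp - x"
  define r where "r = q - x"
  define G where "G = g (x + \<beta> *\<^sub>R D)"
  have L0: "0 \<le> L" using L by (rule lipschitz_on_nonneg)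
  define \<kappa> where "\<kappa> = \<alpha> * \<tau> + \<beta> * L"
  have k0: "0 \<le> \<kappa>" using par L0 \<tau> by (simp add: \<kappa>_def)
  have "(1 - \<alpha>) * \<kappa> = \<alpha> * (\<tau> * (1 - \<alpha>)) + \<beta> * L * (1 - \<alpha>)" by (simp add: \<kappa>_def algebra_simps)
  also have "\<dots> = \<alpha> * (1 + \<epsilon>) * \<delta> + (\<alpha> + \<beta>) * L" unfolding \<tau>(2) by (simp add: algebra_simps)
  also have "\<dots> \<le> (1 - \<alpha>) * ((1 - \<epsilon>) * \<delta>)" using par(6) by (simp add: algebra_simps)
  finally have k1: "\<kappa> \<le> (1 - \<epsilon>) * \<delta>" using par(2) by simp
  have k2: "\<kappa> \<le> \<delta>"
  proof -
    have "0 \<le> \<epsilon> * \<delta>" using par by simp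
    then show ?thesis using k1 by (simp add: algebra_simps)
  qed
  have p: "a + G \<bullet> d + \<tau> / 2 * (norm (d - \<alpha> *\<^sub>R D))\<^sup>2 \<le> b + G \<bullet> r + \<tau> / 2 * (norm (r - \<alpha> *\<^sub>R D))\<^sup>2"
    using prox_inequality[OF xp[folded G_def] \<tau>(1) fin]
    by (simp add: d_def r_def inner_diff_right diff_diff_eq)
  have ex: "(norm (u - \<alpha> *\<^sub>R D))\<^sup>2 = (norm u)\<^sup>2 - 2 * \<alpha> * (u \<bullet> D) + \<alpha>\<^sup>2 * (norm D)\<^sup>2" for u
    unfolding power2_norm_eq_inner
    by (simp add: inner_diff_left inner_diff_right inner_commute power2_eq_square)
  have p': "a + G \<bullet> d + \<tau> / 2 * (norm d)\<^sup>2 - \<tau> * \<alpha> * (d \<bullet> D)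
      \<le> b + G \<bullet> r + \<tau> / 2 * (norm r)\<^sup>2 - \<tau> * \<alpha> * (r \<bullet> D)"
    using p unfolding ex by (simp add: algebra_simps)
  have h1: "h xp \<le> h x + g x \<bullet> d + L / 2 * (norm d)\<^sup>2"
    using lipschitz_gradient_quadratic_bound[OF g L, of xp x] unfolding d_def by linarith
  have h2: "h x + g x \<bullet> r - L / 2 * (norm r)\<^sup>2 \<le> h q"
    using lipschitz_gradient_quadratic_bound[OF g L, of q x] unfolding r_def by linarith
  have nG: "norm (G - g x) \<le> L * \<beta> * norm D"
    using lipschitz_onD[OF L, of "x + \<beta> *\<^sub>R D" x] par by (simp add: G_def dist_norm)
  have c: "\<bar>(G - g x) \<bullet> u\<bar> \<le> \<beta> * L * (norm u * norm D)" for u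
  proof -
    have "\<bar>(G - g x) \<bullet> u\<bar> \<le> norm (G - g x) * norm u" by (rule Cauchy_Schwarz_ineq2)
    also have "\<dots> \<le> (L * \<beta> * norm D) * norm u" using nG by (intro mult_right_mono) auto
    finally show ?thesis by (simp add: mult_ac)
  qed
  have cs: "\<tau> * \<alpha> * \<bar>u \<bullet> D\<bar> \<le> \<tau> * \<alpha> * (norm u * norm D)" for u
    using \<tau> par by (intro mult_left_mono Cauchy_Schwarz_ineq2) auto
  have cs': "\<bar>\<tau> * \<alpha> * (u \<bullet> D)\<bar> \<le> \<tau> * \<alpha> * (norm u * norm D)" for u
    using cs[of u] \<tau> par by (simp add: abs_mult)
  have m: "a + h xp + \<tau> / 2 * (norm d)\<^sup>2 - L / 2 * (norm d)\<^sup>2 - \<kappa> * (norm d * norm D)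
     \<le> b + h q + (L + \<tau>) / 2 * (norm r)\<^sup>2 + \<kappa> * (norm r * norm D)"
    using p' h1 h2 c[of d] c[of r] cs'[of d] cs'[of r]
    by (simp add: \<kappa>_def inner_diff_left algebra_simps abs_le_iff add_divide_distrib)
  \<comment> \<open>The half at \<open>d\<close> is absorbed by the prox term, the half at
    \<open>D\<close> by the old inertial term.\<close>
  have ky: "\<kappa> * (norm d * norm D) \<le> \<kappa> / 2 * (norm d)\<^sup>2 + \<kappa> / 2 * (norm D)\<^sup>2"
  proof -
    have "2 * (norm d * norm D) \<le> (norm d)\<^sup>2 + (norm D)\<^sup>2"
      using sum_squares_bound[of "norm d" "norm D"] by simp
    from mult_left_mono[OF this, of "\<kappa> / 2"] k0 show ?thesis by (simp add: algebra_simps)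
  qed
  have kd: "\<kappa> * (norm r * norm D) \<le> \<delta> * (norm r * norm D)" using k2 by (intro mult_right_mono) auto
  have kD: "\<kappa> / 2 * (norm D)\<^sup>2 \<le> (1 - \<epsilon>) * \<delta> / 2 * (norm D)\<^sup>2" using k1 by (intro mult_right_mono) auto
  have td: "\<tau> / 2 * (norm d)\<^sup>2 = L / 2 * (norm d)\<^sup>2 + \<kappa> / 2 * (norm d)\<^sup>2 + (1 + \<epsilon>) * \<delta> / 2 * (norm d)\<^sup>2"
  proof -
    have "\<tau> = L + \<kappa> + (1 + \<epsilon>) * \<delta>" using \<tau>(2) by (simp add: \<kappa>_def algebra_simps)
    then show ?thesis by (simp only: distrib_right add_divide_distrib)
  qed
  show ?thesis using m ky kd kD td unfolding d_def[symmetric] r_def[symmetric]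
    by (simp add: algebra_simps diff_divide_distrib add_divide_distrib)
qed

text \<open>Expanding the squares around \<open>xp\<close> shows that
  \<open>- (g + \<tau> *\<^sub>R (xp - y))\<close> is a proximal subgradient of \<open>f\<close> at
  \<open>xp\<close>.\<close>

lemma prox_proximal_subgradient:
  assumes xp: "xp \<in> prox \<tau> f (y - (1 / \<tau>) *\<^sub>R g)" and \<tau>: "\<tau> > 0"
    and fin: "f xp = ereal a" "f q = ereal b"
  shows "a - (g + \<tau> *\<^sub>R (xp - y)) \<bullet> (q - xp) - \<tau> / 2 * (norm (q - xp))\<^sup>2 \<le> b"
proof -
  have sq: "(norm (s + p))\<^sup>2 = (norm s)\<^sup>2 + 2 * (p \<bullet> s) + (norm p)\<^sup>2" for s p :: 'a
    unfolding power2_norm_eq_inner by (simp add: inner_add_left inner_add_right inner_commute[of s p])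
  have "(norm (q - y))\<^sup>2 = (norm (q - xp))\<^sup>2 + 2 * ((xp - y) \<bullet> (q - xp)) + (norm (xp - y))\<^sup>2"
    using sq[of "q - xp" "xp - y"] by simp
  then have "\<tau> / 2 * (norm (q - y))\<^sup>2
      = \<tau> / 2 * (norm (q - xp))\<^sup>2 + \<tau> * ((xp - y) \<bullet> (q - xp)) + \<tau> / 2 * (norm (xp - y))\<^sup>2"
    by (simp add: distrib_left)
  moreover have "(g + \<tau> *\<^sub>R (xp - y)) \<bullet> (q - xp) = g \<bullet> q - g \<bullet> xp + \<tau> * ((xp - y) \<bullet> (q - xp))"
    by (simp add: inner_add_left inner_diff_right[of g])
  ultimately show ?thesis using prox_inequality[OF xp \<tau> fin] by linarith
qed

section \<open>Gradients and partial gradients\<close>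

lemma gradient_eqI:
  assumes "GDERIV h x :> D"
  shows "gradient h x = D"
  unfolding gradient_def
proof (rule the_equality[where P = "\<lambda>D. GDERIV h x :> D", OF assms])
  fix D' assume "GDERIV h x :> D'"
  then have "(\<lambda>v. v \<bullet> D') = (\<lambda>v. v \<bullet> D)"
    using assms unfolding gderiv_def by (rule has_derivative_unique)
  then show "D' = D" by (metis vector_eq_ldot)
qed

lemma GDERIV_gradient:
  fixes h :: "'a::euclidean_space \<Rightarrow> real"
  assumes "h differentiable (at p)"
  shows "GDERIV h p :> gradient h p"
proof -
  obtain h' where h': "(h has_derivative h') (at p)" using assms by (auto simp: differentiable_def)
  then have lin: "linear h'" by (rule has_derivative_linear)
  define D where "D = (\<Sum>b\<in>Basis. h' b *\<^sub>R b)"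
  have "h' v = v \<bullet> D" for v
  proof -
    have "h' v = h' (\<Sum>b\<in>Basis. (v \<bullet> b) *\<^sub>R b)" by (simp add: euclidean_representation)
    also have "\<dots> = (\<Sum>b\<in>Basis. (v \<bullet> b) * h' b)"
      by (simp add: linear_sum[OF lin] linear_cmul[OF lin])
    finally show ?thesis by (simp add: D_def inner_sum_right mult.commute)
  qed
  then have "h' = (\<lambda>v. v \<bullet> D)" by auto
  then have "GDERIV h p :> D" using h' by (simp add: gderiv_def)
  then show ?thesis using gradient_eqI by metis
qed

lemma GDERIV_Pair_left:
  assumes "GDERIV H (u, v) :> G"
  shows "GDERIV (\<lambda>u. H (u, v)) u :> fst G"
proof -
  have "((\<lambda>u. (u, v)) has_derivative (\<lambda>h. (h, 0))) (at u)"
    by (auto intro!: derivative_eq_intros)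
  from has_derivative_compose[OF this assms[unfolded gderiv_def]]
  show ?thesis by (simp add: gderiv_def inner_prod_def)
qed

lemma GDERIV_Pair_right:
  assumes "GDERIV H (u, v) :> G"
  shows "GDERIV (\<lambda>v. H (u, v)) v :> snd G"
proof -
  have "((\<lambda>v. (u, v)) has_derivative (\<lambda>h. (0, h))) (at v)"
    by (auto intro!: derivative_eq_intros)
  from has_derivative_compose[OF this assms[unfolded gderiv_def]]
  show ?thesis by (simp add: gderiv_def inner_prod_def)
qed

text \<open>The mean value inequality for \<open>\<lambda>u. H (q, u) - H (p, u)\<close>, whose
  gradient is a difference of values of \<open>G\<close> at distance \<open>norm (q - p)\<close>. It
  controls the coupling error when the estimates of the two blocks are added.\<close>

lemma cross_difference_bound:
  fixes H :: "'a::euclidean_space \<times> 'b::euclidean_space \<Rightarrow> real"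
  assumes G: "\<And>p. GDERIV H p :> G p" and M: "M-lipschitz_on K G"
    and V: "convex V" "v \<in> V" "w \<in> V" and K: "\<And>u. u \<in> V \<Longrightarrow> (p, u) \<in> K \<and> (q, u) \<in> K"
  shows "\<bar>(H (q, w) - H (p, w)) - (H (q, v) - H (p, v))\<bar> \<le> M * norm (q - p) * norm (w - v)"
proof -
  define g where "g u = snd (G (q, u)) - snd (G (p, u))" for u
  have der: "((\<lambda>u. H (q, u) - H (p, u)) has_derivative (\<lambda>h. h \<bullet> g u)) (at u within V)" for u
    using GDERIV_Pair_right[OF G, of q u] GDERIV_Pair_right[OF G, of p u]
    unfolding gderiv_def g_def inner_diff_right
    by (intro has_derivative_diff) (auto intro: has_derivative_at_withinI)
  have "norm (g u) \<le> M * norm (q - p)" if "u \<in> V" for u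
  proof -
    have "norm (g u) \<le> norm (G (q, u) - G (p, u))"
      unfolding g_def by (metis norm_snd_le prod.collapse snd_diff)
    also have "\<dots> \<le> M * norm ((q, u) - (p, u))"
      using lipschitz_onD[OF M, of "(q, u)" "(p, u)"] K[OF that] by (simp add: dist_norm)
    finally show ?thesis by simp
  qed
  then have on: "onorm (\<lambda>h. h \<bullet> g u) \<le> M * norm (q - p)" if "u \<in> V" for u
  proof (intro onorm_le)
    fix h
    have "norm (h \<bullet> g u) \<le> norm h * norm (g u)" by (simp add: Cauchy_Schwarz_ineq2)
    also have "\<dots> \<le> norm h * (M * norm (q - p))"
      using \<open>\<And>u. u \<in> V \<Longrightarrow> norm (g u) \<le> M * norm (q - p)\<close>[OF that] by (rule mult_left_mono) simp
    finally show "norm (h \<bullet> g u) \<le> M * norm (q - p) * norm h" by (simp add: mult_ac)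
  qed
  have "norm ((H (q, w) - H (p, w)) - (H (q, v) - H (p, v))) \<le> M * norm (q - p) * norm (w - v)"
    by (rule differentiable_bound[OF V(1) der on V(3) V(2)])
  then show ?thesis by simp
qed

section \<open>The iPALM iteration\<close>

locale ipalm_run =
  fixes f1 :: "'a::euclidean_space \<Rightarrow> ereal" and f2 :: "'b::euclidean_space \<Rightarrow> ereal"
    and H :: "'a \<times> 'b \<Rightarrow> real" and L1 :: "'b \<Rightarrow> real" and L2 :: "'a \<Rightarrow> real"
    and lm1 lp1 lm2 lp2 \<epsilon> ab1 ab2 bb1 bb2 :: real
    and \<alpha>1 \<alpha>2 \<beta>1 \<beta>2 \<tau>1 \<tau>2 :: "nat \<Rightarrow> real"
    and x1 :: "nat \<Rightarrow> 'a" and x2 :: "nat \<Rightarrow> 'b"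
  assumes A: "assumption_A f1 f2 H L1 L2 lm1 lp1 lm2 lp2"
    and alg: "iPALM f1 f2 H \<alpha>1 \<alpha>2 \<beta>1 \<beta>2 \<tau>1 \<tau>2 x1 x2"
    and \<epsilon>: "0 < \<epsilon>"
    and B1: "assumption_B \<epsilon> ab1 bb1 \<alpha>1 \<beta>1"
    and B2: "assumption_B \<epsilon> ab2 bb2 \<alpha>2 \<beta>2"
    and step: "step_rule \<epsilon> (step_delta \<epsilon> ab1 bb1 lp1) (step_delta \<epsilon> ab2 bb2 lp2) L1 L2
           \<alpha>1 \<alpha>2 \<beta>1 \<beta>2 \<tau>1 \<tau>2 x1 x2"
    and bdd: "bounded (range (\<lambda>k. (x1 k, x2 k)))"
    and KL: "KL_function (objective f1 f2 H)"
begin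

abbreviation "F \<equiv> objective f1 f2 H"
abbreviation "\<delta>1 \<equiv> step_delta \<epsilon> ab1 bb1 lp1"
abbreviation "\<delta>2 \<equiv> step_delta \<epsilon> ab2 bb2 lp2"

definition x :: "nat \<Rightarrow> 'a \<times> 'b" where "x k = (x1 k, x2 k)"
text \<open>Truncated subtraction makes \<open>D1 0\<close>, \<open>D2 0\<close> and
  \<open>d 0\<close> vanish; the step estimates start at \<open>k = 1\<close>.\<close>

definition D1 :: "nat \<Rightarrow> 'a" where "D1 k = x1 k - x1 (k - 1)"
definition D2 :: "nat \<Rightarrow> 'b" where "D2 k = x2 k - x2 (k - 1)"
definition d :: "nat \<Rightarrow> real" where "d k = norm (x k - x (k - 1))"
definition inertia :: "nat \<Rightarrow> real" where
  "inertia k = \<delta>1 / 2 * (norm (D1 k))\<^sup>2 + \<delta>2 / 2 * (norm (D2 k))\<^sup>2"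

section \<open>Consequences of the assumptions along the run\<close>

lemma properF: "F p \<noteq> -\<infinity>" and lscF: "lsc F"
  using KL unfolding KL_function_def proper_def by blast+

lemma proper1: "proper f1"
  using A unfolding assumption_A_def by (elim conjE)

lemma proper2: "proper f2"
  using A unfolding assumption_A_def by (elim conjE)

lemma lp_pos: "0 < lp1" "0 < lp2"
proof -
  show "0 < lp1" using A unfolding assumption_A_def by (elim conjE)
  show "0 < lp2" using A unfolding assumption_A_def by (elim conjE)
qed

lemma inf_F: "(INF p. F p) > -\<infinity>"
  using A unfolding assumption_A_def by (elim conjE)

lemma G: "GDERIV H p :> gradient H p"
proof -
  have "\<forall>x. H differentiable (at x)" using A unfolding assumption_A_def by (elim conjE)
  then show ?thesis by (intro GDERIV_gradient) (rule spec)
qed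

lemma grad_eq: "grad1 H u v = fst (gradient H (u, v))" "grad2 H u v = snd (gradient H (u, v))"
  unfolding grad1_def grad2_def by (intro gradient_eqI GDERIV_Pair_left GDERIV_Pair_right G)+

lemma G1: "GDERIV (\<lambda>u. H (u, v)) u :> grad1 H u v"
  and G2: "GDERIV (\<lambda>v. H (u, v)) v :> grad2 H u v"
  unfolding grad_eq by (rule GDERIV_Pair_left[OF G], rule GDERIV_Pair_right[OF G])

lemma lip1: "(L1 v)-lipschitz_on UNIV (\<lambda>u. grad1 H u v)"
proof -
  have "\<forall>x2. (L1 x2)-lipschitz_on UNIV (\<lambda>x1. grad1 H x1 x2)"
    using A unfolding assumption_A_def by (elim conjE)
  then show ?thesis by (rule spec)
qed

lemma lip2: "(L2 u)-lipschitz_on UNIV (\<lambda>v. grad2 H u v)"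
proof -
  have "\<forall>x1. (L2 x1)-lipschitz_on UNIV (\<lambda>x2. grad2 H x1 x2)"
    using A unfolding assumption_A_def by (elim conjE)
  then show ?thesis by (rule spec)
qed

lemma modulus_bounds: "0 \<le> L1 v" "L1 v \<le> lp1" "0 \<le> L2 u" "L2 u \<le> lp2"
proof -
  show "0 \<le> L1 v" "0 \<le> L2 u" using lip1 lip2 by (auto intro: lipschitz_on_nonneg)
  have "\<forall>B1 B2. compact B1 \<and> compact B2 \<longrightarrow>
        ereal lm1 \<le> (INF x2\<in>B2. ereal (L1 x2)) \<and> (SUP x2\<in>B2. ereal (L1 x2)) \<le> ereal lp1 \<and>
        ereal lm2 \<le> (INF x1\<in>B1. ereal (L2 x1)) \<and> (SUP x1\<in>B1. ereal (L2 x1)) \<le> ereal lp2"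
    using A unfolding assumption_A_def by (elim conjE)
  \<comment> \<open>Singletons are compact, so the uniform bounds hold pointwise.\<close>
  from this[rule_format, of "{u}" "{v}"] show "L1 v \<le> lp1" "L2 u \<le> lp2" by simp_all
qed

lemmas L1_bounds = modulus_bounds(1,2)
lemmas L2_bounds = modulus_bounds(3,4)

text \<open>\<open>step_delta\<close> solves
  \<open>(1 - \<epsilon> - 2 * ab) * \<delta> = (ab + bb) * lp\<close>. The last claim is the
  condition on \<open>\<delta>\<close> in \<open>inertial_prox_estimate\<close>.\<close>

lemma step_delta_props:
  assumes B: "assumption_B \<epsilon> ab bb \<alpha> \<beta>" and lp: "0 < lp" and L: "0 \<le> L" "L \<le> lp" and k: "1 \<le> k"
  shows "0 < step_delta \<epsilon> ab bb lp" "0 \<le> \<alpha> k" "\<alpha> k < 1" "0 \<le> \<beta> k" "0 < 1 - ab" "1 - ab \<le> 1 - \<alpha> k"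
    "2 * \<alpha> k * step_delta \<epsilon> ab bb lp + (\<alpha> k + \<beta> k) * L \<le> (1 - \<epsilon>) * step_delta \<epsilon> ab bb lp"
proof -
  have b: "0 < ab" "0 < 1 - \<epsilon> - 2 * ab" "0 < bb" "0 \<le> \<alpha> k" "\<alpha> k \<le> ab" "0 \<le> \<beta> k" "\<beta> k \<le> bb"
    using B k by (auto simp: assumption_B_def)
  show "0 \<le> \<alpha> k" "\<alpha> k < 1" "0 \<le> \<beta> k" "0 < 1 - ab" "1 - ab \<le> 1 - \<alpha> k" using b \<epsilon> by auto
  let ?d = "step_delta \<epsilon> ab bb lp"
  show d: "0 < ?d" using b lp by (simp add: step_delta_def)
  have "(\<alpha> k + \<beta> k) * L \<le> (ab + bb) * lp" using b L by (intro mult_mono) auto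
  also have "\<dots> = (1 - \<epsilon> - 2 * ab) * ?d" using b by (simp add: step_delta_def)
  finally have "(\<alpha> k + \<beta> k) * L \<le> (1 - \<epsilon> - 2 * ab) * ?d" .
  moreover have "2 * \<alpha> k * ?d \<le> 2 * ab * ?d" using b d by (intro mult_right_mono) auto
  ultimately show "2 * \<alpha> k * ?d + (\<alpha> k + \<beta> k) * L \<le> (1 - \<epsilon>) * ?d" by (simp add: algebra_simps)
qed

lemma delta_pos: "0 < \<delta>1" "0 < \<delta>2"
  using step_delta_props(1)[OF B1 lp_pos(1), of 0 1] step_delta_props(1)[OF B2 lp_pos(2), of 0 1] lp_pos by auto

text \<open>Uniform bounds for the step parameters, from \<open>\<beta> \<le> 1\<close> and the
  bound on the modulus in the numerator and \<open>\<alpha> \<le> ab\<close> in the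
  denominator.\<close>

definition "T1 = ((1 + \<epsilon>) * \<delta>1 + 2 * lp1) / (1 - ab1)"
definition "T2 = ((1 + \<epsilon>) * \<delta>2 + 2 * lp2) / (1 - ab2)"

lemma coeffs:
  assumes k: "1 \<le> k"
  shows "0 < \<tau>1 k" "0 < \<tau>2 k" "\<alpha>1 k \<in> {0..1}" "\<alpha>2 k \<in> {0..1}" "\<beta>1 k \<in> {0..1}" "\<beta>2 k \<in> {0..1}"
    "\<tau>1 k * (1 - \<alpha>1 k) = (1 + \<epsilon>) * \<delta>1 + (1 + \<beta>1 k) * L1 (x2 k)"
    "\<tau>2 k * (1 - \<alpha>2 k) = (1 + \<epsilon>) * \<delta>2 + (1 + \<beta>2 k) * L2 (x1 (Suc k))"
    "\<tau>1 k \<le> T1" "\<tau>2 k \<le> T2"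
    "x1 (Suc k) \<in> prox (\<tau>1 k) f1 (x1 k + \<alpha>1 k *\<^sub>R D1 k - (1 / \<tau>1 k) *\<^sub>R grad1 H (x1 k + \<beta>1 k *\<^sub>R D1 k) (x2 k))"
    "x2 (Suc k) \<in> prox (\<tau>2 k) f2 (x2 k + \<alpha>2 k *\<^sub>R D2 k - (1 / \<tau>2 k) *\<^sub>R grad2 H (x1 (Suc k)) (x2 k + \<beta>2 k *\<^sub>R D2 k))"
proof -
  show c: "0 < \<tau>1 k" "0 < \<tau>2 k" "\<alpha>1 k \<in> {0..1}" "\<alpha>2 k \<in> {0..1}" "\<beta>1 k \<in> {0..1}" "\<beta>2 k \<in> {0..1}"
    and "x1 (Suc k) \<in> prox (\<tau>1 k) f1 (x1 k + \<alpha>1 k *\<^sub>R D1 k - (1 / \<tau>1 k) *\<^sub>R grad1 H (x1 k + \<beta>1 k *\<^sub>R D1 k) (x2 k))"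
    "x2 (Suc k) \<in> prox (\<tau>2 k) f2 (x2 k + \<alpha>2 k *\<^sub>R D2 k - (1 / \<tau>2 k) *\<^sub>R grad2 H (x1 (Suc k)) (x2 k + \<beta>2 k *\<^sub>R D2 k))"
    using alg k by (auto simp: iPALM_def D1_def D2_def Let_def)
  note p1 = step_delta_props[OF B1 lp_pos(1) L1_bounds[of "x2 k"] k]
  note p2 = step_delta_props[OF B2 lp_pos(2) L2_bounds[of "x1 (Suc k)"] k]
  have t: "\<tau>1 k = ((1 + \<epsilon>) * \<delta>1 + (1 + \<beta>1 k) * L1 (x2 k)) / (1 - \<alpha>1 k)"
     "\<tau>2 k = ((1 + \<epsilon>) * \<delta>2 + (1 + \<beta>2 k) * L2 (x1 (Suc k))) / (1 - \<alpha>2 k)"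
    using step k by (auto simp: step_rule_def)
  show "\<tau>1 k * (1 - \<alpha>1 k) = (1 + \<epsilon>) * \<delta>1 + (1 + \<beta>1 k) * L1 (x2 k)"
    "\<tau>2 k * (1 - \<alpha>2 k) = (1 + \<epsilon>) * \<delta>2 + (1 + \<beta>2 k) * L2 (x1 (Suc k))"
    using t p1(3) p2(3) by auto
  have "(1 + \<beta>1 k) * L1 (x2 k) \<le> 2 * lp1" "(1 + \<beta>2 k) * L2 (x1 (Suc k)) \<le> 2 * lp2"
    using c L1_bounds[of "x2 k"] L2_bounds[of "x1 (Suc k)"] by (intro mult_mono; simp)+
  then show "\<tau>1 k \<le> T1" "\<tau>2 k \<le> T2"
    unfolding t T1_def T2_def using p1 p2 delta_pos \<epsilon> lp_pos by (intro frac_le; simp)+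
qed

lemma F_eq: "F (u, v) = f1 u + f2 v + ereal (H (u, v))"
  by (simp add: objective_def)

lemma F_real_cases:
  assumes "F (u, v) = ereal c"
  obtains c1 c2 where "f1 u = ereal c1" "f2 v = ereal c2" "c = c1 + c2 + H (u, v)"
  using assms proper1 proper2 unfolding F_eq proper_def
  by (cases "f1 u"; cases "f2 v") (auto)

text \<open>From index 2 on the iterates are outputs of prox steps; the initial points
  \<open>x 0\<close> and \<open>x 1\<close> may lie outside the domain of \<open>F\<close>.\<close>

lemma F_finite:
  assumes "2 \<le> k"
  obtains c1 c2 where "f1 (x1 k) = ereal c1" "f2 (x2 k) = ereal c2" "F (x k) = ereal (c1 + c2 + H (x k))"
proof -
  obtain j where j: "k = Suc j" "1 \<le> j" using assms by (cases k) auto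
  obtain c1 where "f1 (x1 k) = ereal c1" using prox_finite[OF proper1 coeffs(11)[OF j(2)]] j by blast
  moreover obtain c2 where "f2 (x2 k) = ereal c2" using prox_finite[OF proper2 coeffs(12)[OF j(2)]] j by blast
  ultimately show ?thesis using that by (simp add: x_def F_eq)
qed

lemma d_eq: "d k = norm (D1 k, D2 k)"
  by (simp add: d_def x_def D1_def D2_def)

lemma norm_D_le: "norm (D1 k) \<le> d k" "norm (D2 k) \<le> d k"
  unfolding d_eq by (rule norm_fst_le, rule norm_snd_le)

lemma d_sq: "(d k)\<^sup>2 = (norm (D1 k))\<^sup>2 + (norm (D2 k))\<^sup>2"
  unfolding d_eq by (simp add: norm_Pair)

lemma d_nonneg: "0 \<le> d k" by (simp add: d_def)

text \<open>The radius covers all points where \<open>gradient H\<close> is compared: one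
  extrapolated block of norm at most \<open>3 * R\<close> paired with a block of norm at most
  \<open>R\<close>, and pairs of blocks of norm at most \<open>R + 1\<close>.\<close>

lemma ball_data:
  obtains R M where "0 \<le> R" "\<And>k. norm (x1 k) \<le> R" "\<And>k. norm (x2 k) \<le> R"
    "M-lipschitz_on (cball 0 (4 * R + 2)) (gradient H)" "0 \<le> M"
proof -
  obtain R where R: "\<And>k. norm (x1 k, x2 k) \<le> R" using bdd by (auto simp: bounded_iff)
  have n: "norm (x1 k) \<le> R" "norm (x2 k) \<le> R" for k
    using R[of k] norm_fst_le[of "x1 k" "x2 k"] norm_snd_le[of "x2 k" "x1 k"] by linarith+
  obtain M where M: "M-lipschitz_on (cball 0 (4 * R + 2)) (gradient H)"
  proof -
    have "\<forall>B. bounded B \<longrightarrow> (\<exists>M. M-lipschitz_on B (gradient H))"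
      using A unfolding assumption_A_def by (elim conjE)
    then show ?thesis using that bounded_cball by blast
  qed
  have "0 \<le> R" using R[of 0] norm_ge_zero order_trans by blast
  then show ?thesis using that n M lipschitz_on_nonneg[OF M] by blast
qed

lemma D_Suc: "D1 (Suc k) = x1 (Suc k) - x1 k" "D2 (Suc k) = x2 (Suc k) - x2 k"
  by (simp_all add: D1_def D2_def)

section \<open>Descent and small subgradients\<close>

lemma T_pos: "0 < T1" "0 < T2"
  using coeffs(1,2,9,10)[of 1] by auto

text \<open>The comparison point \<open>p\<close> is deliberately arbitrary: \<open>p = x k\<close> gives sufficient decrease, a cluster
  point \<open>p\<close> gives convergence of the function values, and a small \<open>norm (p - x k)\<close> gives the lower
  bound of \<open>F\<close> that the error bound needs.\<close>

lemma descent_estimate: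
  obtains a C where "0 < a" "a \<le> C"
    "\<And>k p c r. 1 \<le> k \<Longrightarrow> norm (p - x k) \<le> 1 \<Longrightarrow> F p = ereal c \<Longrightarrow> F (x (Suc k)) = ereal r \<Longrightarrow>
       r + inertia (Suc k) + a * ((d (Suc k))\<^sup>2 + (d k)\<^sup>2)
       \<le> c + inertia k + C * (norm (p - x k))\<^sup>2 + C * norm (p - x k) * (d (Suc k) + d k)"
proof -
  obtain R M where R: "0 \<le> R" "\<And>k. norm (x1 k) \<le> R" "\<And>k. norm (x2 k) \<le> R"
    and M: "M-lipschitz_on (cball 0 (4 * R + 2)) (gradient H)" "0 \<le> M"
    using ball_data by blast
  define a where "a = min (\<epsilon> * \<delta>1 / 2) (\<epsilon> * \<delta>2 / 2)"
  define c0 where "c0 = (lp1 + T1) / 2 + (lp2 + T2) / 2"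
  \<comment> \<open>Collects the coefficients of both error terms; the summand \<open>a\<close>
    provides \<open>a \<le> C\<close>.\<close>
  define C where "C = c0 + (\<delta>1 + \<delta>2) + M + a"
  have a: "0 < a" "a \<le> \<epsilon> * \<delta>1 / 2" "a \<le> \<epsilon> * \<delta>2 / 2" using \<epsilon> delta_pos by (auto simp: a_def)
  have c0: "0 < c0" using lp_pos T_pos by (simp add: c0_def add_pos_pos)
  show ?thesis
  proof (rule that[of a C])
    show "0 < a" "a \<le> C" using a c0 M delta_pos by (auto simp: C_def)
    fix k p c r assume k: "1 \<le> k" and near: "norm (p - x k) \<le> 1" and Fp: "F p = ereal c"
      and Fx: "F (x (Suc k)) = ereal r"
    obtain q1 q2 where p: "p = (q1, q2)" by (cases p)
    obtain c1 c2 where c: "f1 q1 = ereal c1" "f2 q2 = ereal c2" "c = c1 + c2 + H (q1, q2)"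
      using Fp F_real_cases unfolding p by blast
    obtain r1 r2 where r: "f1 (x1 (Suc k)) = ereal r1" "f2 (x2 (Suc k)) = ereal r2"
        "r = r1 + r2 + H (x1 (Suc k), x2 (Suc k))"
      using Fx F_real_cases unfolding x_def by blast
    define \<rho> where "\<rho> = norm (p - x k)"
    have \<rho>0: "0 \<le> \<rho>" by (simp add: \<rho>_def)
    have pe: "p - x k = (q1 - x1 k, q2 - x2 k)" by (simp add: p x_def)
    have \<rho>1: "norm (q1 - x1 k) \<le> \<rho>" and \<rho>2: "norm (q2 - x2 k) \<le> \<rho>"
      unfolding \<rho>_def pe by (rule norm_fst_le, rule norm_snd_le)
    note s1 = step_delta_props[OF B1 lp_pos(1) L1_bounds[of "x2 k"] k]
    note s2 = step_delta_props[OF B2 lp_pos(2) L2_bounds[of "x1 (Suc k)"] k]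
    note co = coeffs[OF k]
    have e1: "r1 + H (x1 (Suc k), x2 k) + \<delta>1 / 2 * (norm (D1 (Suc k)))\<^sup>2
        + \<epsilon> * \<delta>1 / 2 * ((norm (D1 (Suc k)))\<^sup>2 + (norm (D1 k))\<^sup>2)
      \<le> c1 + H (q1, x2 k) + \<delta>1 / 2 * (norm (D1 k))\<^sup>2
        + (L1 (x2 k) + \<tau>1 k) / 2 * (norm (q1 - x1 k))\<^sup>2 + \<delta>1 * norm (q1 - x1 k) * norm (D1 k)"
      using inertial_prox_estimate[OF G1 lip1 co(11) co(1) co(7) s1(2,3,4) less_imp_le[OF \<epsilon>] less_imp_le[OF s1(1)] s1(7) r(1) c(1)]
      unfolding D_Suc .
    have e2: "r2 + H (x1 (Suc k), x2 (Suc k)) + \<delta>2 / 2 * (norm (D2 (Suc k)))\<^sup>2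
        + \<epsilon> * \<delta>2 / 2 * ((norm (D2 (Suc k)))\<^sup>2 + (norm (D2 k))\<^sup>2)
      \<le> c2 + H (x1 (Suc k), q2) + \<delta>2 / 2 * (norm (D2 k))\<^sup>2
        + (L2 (x1 (Suc k)) + \<tau>2 k) / 2 * (norm (q2 - x2 k))\<^sup>2 + \<delta>2 * norm (q2 - x2 k) * norm (D2 k)"
      using inertial_prox_estimate[OF G2 lip2 co(12) co(2) co(8) s2(2,3,4) less_imp_le[OF \<epsilon>] less_imp_le[OF s2(1)] s2(7) r(2) c(2)]
      unfolding D_Suc .
    \<comment> \<open>The block estimates compare with \<open>H (q1, x2 k)\<close> and
      \<open>H (x1 (Suc k), q2)\<close> instead of \<open>H (q1, q2)\<close>; adding them leaves
      this mixed difference. Its bound vanishes for \<open>p = x k\<close>.\<close>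
    have cr: "\<bar>(H (q1, q2) - H (x1 (Suc k), q2)) - (H (q1, x2 k) - H (x1 (Suc k), x2 k))\<bar>
        \<le> M * norm (q1 - x1 (Suc k)) * norm (q2 - x2 k)"
    proof (rule cross_difference_bound[OF G M(1), where V = "cball 0 (R + 1)"])
      have "norm q1 \<le> R + 1" "norm q2 \<le> R + 1"
        using near \<rho>1 \<rho>2 R(2)[of k] R(3)[of k] norm_triangle_sub[of q1 "x1 k"] norm_triangle_sub[of q2 "x2 k"]
        by (auto simp: \<rho>_def)
      note n = this
      show "q2 \<in> cball 0 (R + 1)" "x2 k \<in> cball 0 (R + 1)" using n R(3)[of k] by auto
      fix u :: 'b assume u: "u \<in> cball 0 (R + 1)"
      have "norm (v, u) \<le> 4 * R + 2" if "norm v \<le> R + 1" for v :: 'a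
        using norm_Pair_le[of v u] that u R(1) by simp
      then show "(x1 (Suc k), u) \<in> cball 0 (4 * R + 2) \<and> (q1, u) \<in> cball 0 (4 * R + 2)"
        using n R(2)[of "Suc k"] by simp
    qed simp
    have "norm (q1 - x1 (Suc k)) \<le> \<rho> + d (Suc k)"
      using norm_triangle_ineq4[of "q1 - x1 k" "D1 (Suc k)"] \<rho>1 norm_D_le(1)[of "Suc k"] by (simp add: D_Suc)
    then have "M * norm (q1 - x1 (Suc k)) * norm (q2 - x2 k) \<le> M * (\<rho> + d (Suc k)) * \<rho>"
      using M \<rho>2 \<rho>0 d_nonneg by (intro mult_mono mult_left_mono) auto
    with cr have cr': "H (q1, x2 k) + H (x1 (Suc k), q2) \<le> H (q1, q2) + H (x1 (Suc k), x2 k) + M * (\<rho> + d (Suc k)) * \<rho>"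
      by linarith
    have b1: "(L1 (x2 k) + \<tau>1 k) / 2 * (norm (q1 - x1 k))\<^sup>2 \<le> (lp1 + T1) / 2 * \<rho>\<^sup>2"
      using L1_bounds[of "x2 k"] co(1,9) \<rho>1 lp_pos T_pos by (intro mult_mono power_mono) auto
    have b2: "(L2 (x1 (Suc k)) + \<tau>2 k) / 2 * (norm (q2 - x2 k))\<^sup>2 \<le> (lp2 + T2) / 2 * \<rho>\<^sup>2"
      using L2_bounds[of "x1 (Suc k)"] co(2,10) \<rho>2 lp_pos T_pos by (intro mult_mono power_mono) auto
    have b3: "\<delta>1 * norm (q1 - x1 k) * norm (D1 k) \<le> \<delta>1 * \<rho> * d k"
      using delta_pos \<rho>1 norm_D_le(1)[of k] \<rho>0 by (intro mult_mono mult_left_mono) auto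
    have b4: "\<delta>2 * norm (q2 - x2 k) * norm (D2 k) \<le> \<delta>2 * \<rho> * d k"
      using delta_pos \<rho>2 norm_D_le(2)[of k] \<rho>0 by (intro mult_mono mult_left_mono) auto
    have a1: "a * ((norm (D1 (Suc k)))\<^sup>2 + (norm (D1 k))\<^sup>2) \<le> \<epsilon> * \<delta>1 / 2 * ((norm (D1 (Suc k)))\<^sup>2 + (norm (D1 k))\<^sup>2)"
      using a(2) by (rule mult_right_mono) simp
    have a2: "a * ((norm (D2 (Suc k)))\<^sup>2 + (norm (D2 k))\<^sup>2) \<le> \<epsilon> * \<delta>2 / 2 * ((norm (D2 (Suc k)))\<^sup>2 + (norm (D2 k))\<^sup>2)"
      using a(3) by (rule mult_right_mono) simp
    have ad: "a * ((d (Suc k))\<^sup>2 + (d k)\<^sup>2) = a * ((norm (D1 (Suc k)))\<^sup>2 + (norm (D1 k))\<^sup>2)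
        + a * ((norm (D2 (Suc k)))\<^sup>2 + (norm (D2 k))\<^sup>2)"
      unfolding d_sq by (simp add: algebra_simps)
    have fin: "c0 * \<rho>\<^sup>2 + \<delta>1 * \<rho> * d k + \<delta>2 * \<rho> * d k + M * (\<rho> + d (Suc k)) * \<rho>
       \<le> C * \<rho>\<^sup>2 + C * \<rho> * (d (Suc k) + d k)"
    proof -
      have "0 \<le> (\<delta>1 + \<delta>2 + a) * \<rho>\<^sup>2" "0 \<le> (c0 + M + a) * (\<rho> * d k)"
        "0 \<le> (c0 + (\<delta>1 + \<delta>2) + a) * (\<rho> * d (Suc k))"
        using delta_pos a c0 M \<rho>0 d_nonneg by (intro mult_nonneg_nonneg; simp)+
      then show ?thesis unfolding C_def by (simp add: algebra_simps power2_eq_square)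
    qed
    have "(lp1 + T1) / 2 * \<rho>\<^sup>2 + (lp2 + T2) / 2 * \<rho>\<^sup>2 = c0 * \<rho>\<^sup>2" by (simp add: c0_def distrib_right)
    then show "r + inertia (Suc k) + a * ((d (Suc k))\<^sup>2 + (d k)\<^sup>2)
       \<le> c + inertia k + C * (norm (p - x k))\<^sup>2 + C * norm (p - x k) * (d (Suc k) + d k)"
      using e1 e2 cr' b1 b2 b3 b4 a1 a2 fin
      unfolding ad r(3) c(3) inertia_def \<rho>_def[symmetric] by linarith
  qed
qed

text \<open>Each prox step supplies a proximal subgradient of \<open>f1\<close> or
  \<open>f2\<close>, built with a gradient of \<open>H\<close> at an extrapolated point. Replacing
  it by the gradient at the new iterate costs Lipschitz errors of the order of the step
  lengths.\<close>

lemma small_subgradient: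
  obtains C where "\<And>k. 1 \<le> k \<Longrightarrow> \<exists>w. w \<in> frechet_subdiff F (x (Suc k)) \<and> norm w \<le> C * (d (Suc k) + d k)"
proof -
  obtain R M where R: "0 \<le> R" "\<And>k. norm (x1 k) \<le> R" "\<And>k. norm (x2 k) \<le> R"
    and M: "M-lipschitz_on (cball 0 (4 * R + 2)) (gradient H)" "0 \<le> M"
    using ball_data by blast
  show ?thesis
  \<comment> \<open>The first block contributes \<open>2 * M\<close>, since both components of the
    argument of the gradient move, the second \<open>M\<close>; \<open>T1\<close> and
    \<open>T2\<close> bound the proximal terms.\<close>
  proof (rule that[of "3 * M + T1 + T2"])
    fix k :: nat assume k: "1 \<le> k"
    note co = coeffs[OF k]
    define z1 where "z1 = x1 k + \<beta>1 k *\<^sub>R D1 k"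
    define z2 where "z2 = x2 k + \<beta>2 k *\<^sub>R D2 k"
    define u1 where "u1 = D1 (Suc k) - \<alpha>1 k *\<^sub>R D1 k"
    define u2 where "u2 = D2 (Suc k) - \<alpha>2 k *\<^sub>R D2 k"
    define g1 where "g1 = grad1 H z1 (x2 k)"
    define g2 where "g2 = grad2 H (x1 (Suc k)) z2"
    define gH where "gH = gradient H (x (Suc k))"
    define w where "w = (fst gH - (g1 + \<tau>1 k *\<^sub>R u1), snd gH - (g2 + \<tau>2 k *\<^sub>R u2))"
    let ?S = "d (Suc k) + d k"
    have comb: "norm (v' - t *\<^sub>R v) \<le> ?S" if "norm v' \<le> d (Suc k)" "norm v \<le> d k" "t \<in> {0..1}"
      for v v' :: "'c::real_normed_vector" and t
    proof -
      have "\<bar>t\<bar> * norm v \<le> 1 * d k" using that by (intro mult_mono) auto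
      then have "norm (t *\<^sub>R v) \<le> d k" by simp
      then show ?thesis using norm_triangle_ineq4[of v' "t *\<^sub>R v"] that by linarith
    qed
    have nu: "norm u1 \<le> ?S" "norm u2 \<le> ?S"
      unfolding u1_def u2_def using norm_D_le co by (auto intro!: comb)
    have tu: "norm (\<tau>1 k *\<^sub>R u1) \<le> T1 * ?S" "norm (\<tau>2 k *\<^sub>R u2) \<le> T2 * ?S"
      using nu co T_pos by (auto intro!: mult_mono)
    have xS: "x (Suc k) \<in> cball 0 (4 * R + 2)"
      using norm_Pair_le[of "x1 (Suc k)" "x2 (Suc k)"] R(1) R(2,3)[of "Suc k"] by (simp add: x_def)
    have ez: "norm (v + t *\<^sub>R (v - v')) \<le> 3 * R" if "norm v \<le> R" "norm v' \<le> R" "t \<in> {0..1}"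
      for v v' :: "'c::real_normed_vector" and t
    proof -
      have "norm (v - v') \<le> 2 * R" using norm_triangle_ineq4[of v v'] that by linarith
      then have "\<bar>t\<bar> * norm (v - v') \<le> 1 * (2 * R)" using that by (intro mult_mono) auto
      then have "norm (t *\<^sub>R (v - v')) \<le> 2 * R" by simp
      then show ?thesis using norm_triangle_ineq[of v "t *\<^sub>R (v - v')"] that by linarith
    qed
    have zz: "norm z1 \<le> 3 * R" "norm z2 \<le> 3 * R"
      unfolding z1_def z2_def D1_def D2_def using R co by (auto intro!: ez)
    have zS: "(z1, x2 k) \<in> cball 0 (4 * R + 2)" "(x1 (Suc k), z2) \<in> cball 0 (4 * R + 2)"
      using norm_Pair_le[of z1 "x2 k"] norm_Pair_le[of "x1 (Suc k)" z2] R(1) R(2)[of "Suc k"] R(3)[of k] zz by auto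
    have w1: "norm (fst gH - g1) \<le> M * (2 * ?S)"
    proof -
      have e: "x (Suc k) - (z1, x2 k) = (D1 (Suc k) - \<beta>1 k *\<^sub>R D1 k, D2 (Suc k))"
        by (simp add: x_def z1_def D_Suc)
      have "norm (D1 (Suc k) - \<beta>1 k *\<^sub>R D1 k) \<le> ?S" using norm_D_le co by (auto intro!: comb)
      then have n: "norm (x (Suc k) - (z1, x2 k)) \<le> 2 * ?S"
        unfolding e using norm_Pair_le[of "D1 (Suc k) - \<beta>1 k *\<^sub>R D1 k" "D2 (Suc k)"]
          norm_D_le(2)[of "Suc k"] d_nonneg[of k] by simp
      have "norm (fst gH - g1) \<le> norm (gH - gradient H (z1, x2 k))"
        unfolding g1_def grad_eq fst_diff[symmetric] by (metis norm_fst_le prod.collapse)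
      also have "\<dots> \<le> M * norm (x (Suc k) - (z1, x2 k))"
        using lipschitz_onD[OF M(1) xS zS(1)] by (simp add: gH_def dist_norm)
      also have "\<dots> \<le> M * (2 * ?S)" using n M(2) by (rule mult_left_mono)
      finally show ?thesis .
    qed
    have w2: "norm (snd gH - g2) \<le> M * ?S"
    proof -
      have e: "x (Suc k) - (x1 (Suc k), z2) = (0, D2 (Suc k) - \<beta>2 k *\<^sub>R D2 k)"
        by (simp add: x_def z2_def D_Suc)
      have "norm (D2 (Suc k) - \<beta>2 k *\<^sub>R D2 k) \<le> ?S" using norm_D_le co by (auto intro!: comb)
      then have n: "norm (x (Suc k) - (x1 (Suc k), z2)) \<le> ?S" unfolding e by simp
      have "norm (snd gH - g2) \<le> norm (gH - gradient H (x1 (Suc k), z2))"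
        unfolding g2_def grad_eq snd_diff[symmetric] by (metis norm_snd_le prod.collapse)
      also have "\<dots> \<le> M * norm (x (Suc k) - (x1 (Suc k), z2))"
        using lipschitz_onD[OF M(1) xS zS(2)] by (simp add: gH_def dist_norm)
      also have "\<dots> \<le> M * ?S" using n M(2) by (rule mult_left_mono)
      finally show ?thesis .
    qed
    have nw: "norm w \<le> (3 * M + T1 + T2) * ?S"
    proof -
      have "norm w \<le> norm (fst gH - g1 - \<tau>1 k *\<^sub>R u1) + norm (snd gH - g2 - \<tau>2 k *\<^sub>R u2)"
        unfolding w_def diff_diff_add[symmetric] by (rule norm_Pair_le)
      then show ?thesis
        using w1 w2 tu norm_triangle_ineq4[of "fst gH - g1" "\<tau>1 k *\<^sub>R u1"]
          norm_triangle_ineq4[of "snd gH - g2" "\<tau>2 k *\<^sub>R u2"] by (simp add: algebra_simps)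
    qed
    obtain r1 r2 where r: "f1 (x1 (Suc k)) = ereal r1" "f2 (x2 (Suc k)) = ereal r2"
        "F (x (Suc k)) = ereal (r1 + r2 + H (x (Suc k)))"
      using F_finite[of "Suc k"] k by auto
    have "w \<in> frechet_subdiff F (x (Suc k))"
    proof (rule frechet_subdiffI[of F "x (Suc k)" "r1 + r2 + H (x (Suc k))", OF r(3)])
      fix e :: real assume e: "0 < e"
      define T where "T = T1 + T2"
      have T: "0 < T" using T_pos by (simp add: T_def)
      have "(H has_derivative (\<lambda>h. h \<bullet> gH)) (at (x (Suc k)))"
        using G[of "x (Suc k)"] by (simp add: gderiv_def gH_def)
      then obtain \<theta> where \<theta>: "0 < \<theta>" and Hd: "\<And>p. norm (p - x (Suc k)) < \<theta> \<Longrightarrow>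
          norm (H p - H (x (Suc k)) - (p - x (Suc k)) \<bullet> gH) \<le> e / 2 * norm (p - x (Suc k))"
        using e unfolding has_derivative_at_alt by (meson half_gt_zero)
      \<comment> \<open>Half of \<open>e\<close> pays for the first-order remainder of
        \<open>H\<close>; the bound \<open>e / T\<close> lets the other half pay for the quadratic
        terms of the proximal subgradients.\<close>
      have "\<forall>\<^sub>F p in at (x (Suc k)). dist p (x (Suc k)) < min \<theta> (e / T)"
        using \<theta> e T by (auto simp: eventually_at intro!: exI[of _ "min \<theta> (e / T)"])
      then show "\<forall>\<^sub>F p in at (x (Suc k)). ereal (r1 + r2 + H (x (Suc k)) + w \<bullet> (p - x (Suc k)) - e * norm (p - x (Suc k))) \<le> F p"
      proof eventually_elim
        case (elim p)
        define n where "n = norm (p - x (Suc k))"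
        have n: "0 \<le> n" "n < \<theta>" "n < e / T" using elim by (auto simp: n_def dist_norm)
        show ?case
        proof (cases "F p")
          case (real c)
          obtain q1 q2 where p: "p = (q1, q2)" by (cases p)
          obtain c1 c2 where c: "f1 q1 = ereal c1" "f2 q2 = ereal c2" "c = c1 + c2 + H (q1, q2)"
            using real F_real_cases unfolding p by blast
          have pe: "p - x (Suc k) = (q1 - x1 (Suc k), q2 - x2 (Suc k))" by (simp add: p x_def)
          have n1: "norm (q1 - x1 (Suc k)) \<le> n" "norm (q2 - x2 (Suc k)) \<le> n"
            unfolding n_def pe by (rule norm_fst_le, rule norm_snd_le)
          have us: "x1 (Suc k) - (x1 k + \<alpha>1 k *\<^sub>R D1 k) = u1" "x2 (Suc k) - (x2 k + \<alpha>2 k *\<^sub>R D2 k) = u2"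
            by (simp_all add: u1_def u2_def D_Suc)
          have p1: "r1 - (g1 + \<tau>1 k *\<^sub>R u1) \<bullet> (q1 - x1 (Suc k)) - \<tau>1 k / 2 * (norm (q1 - x1 (Suc k)))\<^sup>2 \<le> c1"
            using prox_proximal_subgradient[OF co(11) co(1) r(1) c(1)] unfolding us g1_def z1_def .
          have p2: "r2 - (g2 + \<tau>2 k *\<^sub>R u2) \<bullet> (q2 - x2 (Suc k)) - \<tau>2 k / 2 * (norm (q2 - x2 (Suc k)))\<^sup>2 \<le> c2"
            using prox_proximal_subgradient[OF co(12) co(2) r(2) c(2)] unfolding us g2_def z2_def .
          have t1: "\<tau>1 k / 2 * (norm (q1 - x1 (Suc k)))\<^sup>2 \<le> T1 / 2 * n\<^sup>2"
            using co(1,9) n1 T_pos by (intro mult_mono power_mono) auto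
          have t2: "\<tau>2 k / 2 * (norm (q2 - x2 (Suc k)))\<^sup>2 \<le> T2 / 2 * n\<^sup>2"
            using co(2,10) n1 T_pos by (intro mult_mono power_mono) auto
          have "T * n * n \<le> e * n" using n T by (intro mult_right_mono) (auto simp: field_simps)
          then have t3: "T1 / 2 * n\<^sup>2 + T2 / 2 * n\<^sup>2 \<le> e / 2 * n"
            by (simp add: T_def power2_eq_square algebra_simps)
          have "\<bar>H p - H (x (Suc k)) - (p - x (Suc k)) \<bullet> gH\<bar> \<le> e / 2 * n"
            using Hd[of p] n by (simp add: n_def)
          moreover have "w \<bullet> (p - x (Suc k)) = (p - x (Suc k)) \<bullet> gH
              - (g1 + \<tau>1 k *\<^sub>R u1) \<bullet> (q1 - x1 (Suc k)) - (g2 + \<tau>2 k *\<^sub>R u2) \<bullet> (q2 - x2 (Suc k))"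
          proof -
            have "(fst g - v1, snd g - v2) \<bullet> (s1, s2) = (s1, s2) \<bullet> g - v1 \<bullet> s1 - v2 \<bullet> s2"
              for g :: "'a \<times> 'b" and v1 v2 s1 s2
              by (simp add: inner_prod_def inner_diff_left inner_commute[of s1] inner_commute[of s2])
            then show ?thesis unfolding pe w_def .
          qed
          ultimately have "r1 + r2 + H (x (Suc k)) + w \<bullet> (p - x (Suc k)) - e * n \<le> c"
            using p1 p2 t1 t2 t3 c(3) unfolding p by linarith
          then show ?thesis by (simp add: real n_def)
        qed (use properF[of p] in auto)
      qed
    qed
    then show "\<exists>w. w \<in> frechet_subdiff F (x (Suc k)) \<and> norm w \<le> (3 * M + T1 + T2) * ?S"
      using nw by blast
  qed
qed

section \<open>Convergence to a critical point\<close>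

theorem converges_to_critical_point: "\<exists>xs. x \<longlonglongrightarrow> xs \<and> critical_point F xs"
proof -
  obtain a C where aC: "0 < a" "a \<le> C"
    and key: "\<And>k p c r. 1 \<le> k \<Longrightarrow> norm (p - x k) \<le> 1 \<Longrightarrow> F p = ereal c \<Longrightarrow> F (x (Suc k)) = ereal r \<Longrightarrow>
       r + inertia (Suc k) + a * ((d (Suc k))\<^sup>2 + (d k)\<^sup>2)
       \<le> c + inertia k + C * (norm (p - x k))\<^sup>2 + C * norm (p - x k) * (d (Suc k) + d k)"
    using descent_estimate by blast
  \<comment> \<open>At the first two indices \<open>F (x k)\<close> may be infinite, and
    \<open>r k\<close> is then the default \<open>0\<close>; the estimates of \<open>\<Psi>\<close>
    therefore start at \<open>k = 2\<close>.\<close>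
  define r where "r k = real_of_ereal (F (x k))" for k
  define \<Psi> where "\<Psi> k = r k + inertia k" for k
  have val: "F (x k) = ereal (r k)" if "2 \<le> k" for k
    using F_finite[OF that] unfolding r_def by (metis real_of_ereal.simps(1))
  have in0: "0 \<le> inertia k" for k using delta_pos by (simp add: inertia_def)
  have inb: "inertia k \<le> (\<delta>1 + \<delta>2) * (d k)\<^sup>2" for k
  proof -
    have "\<delta>1 / 2 * (norm (D1 k))\<^sup>2 \<le> \<delta>1 * (d k)\<^sup>2" "\<delta>2 / 2 * (norm (D2 k))\<^sup>2 \<le> \<delta>2 * (d k)\<^sup>2"
      using delta_pos norm_D_le[of k] by (intro mult_mono power_mono; simp)+
    then show ?thesis by (simp add: inertia_def algebra_simps)
  qed
  have dec2: "\<Psi> (Suc k) + a * ((d (Suc k))\<^sup>2 + (d k)\<^sup>2) \<le> \<Psi> k" if "2 \<le> k" for k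
    using key[of k "x k" "r k" "r (Suc k)"] val[of k] val[of "Suc k"] that by (simp add: \<Psi>_def)
  have dec: "\<Psi> (Suc k) + a * (d k)\<^sup>2 \<le> \<Psi> k" if "2 \<le> k" for k
    using dec2[OF that] aC mult_nonneg_nonneg[of a "(d (Suc k))\<^sup>2"] zero_le_power2[of "d (Suc k)"]
    unfolding distrib_left by linarith
  obtain m where m: "\<And>p. ereal m \<le> F p"
  proof -
    obtain m where "ereal m < (INF p. F p)" using inf_F ereal_dense2 by blast
    then show ?thesis using that by (meson INF_lower UNIV_I less_imp_le order_trans)
  qed
  have "\<exists>A. \<Psi> \<longlonglongrightarrow> A"
  proof -
    have "decseq (\<lambda>n. \<Psi> (n + 2))"
    proof (rule decseq_SucI)
      fix n show "\<Psi> (Suc n + 2) \<le> \<Psi> (n + 2)"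
      proof -
        have "0 \<le> a * (d (n + 2))\<^sup>2" using aC by simp
        then show ?thesis using dec[of "n + 2"] by simp
      qed
    qed
    moreover have "m \<le> \<Psi> (n + 2)" for n
      using m[of "x (n + 2)"] val[of "n + 2"] in0[of "n + 2"] by (simp add: \<Psi>_def)
    ultimately obtain A where "(\<lambda>n. \<Psi> (n + 2)) \<longlonglongrightarrow> A"
      using decseq_convergent[of "\<lambda>n. \<Psi> (n + 2)" m] by blast
    then show ?thesis using LIMSEQ_offset by blast
  qed
  then obtain A where lim: "\<Psi> \<longlonglongrightarrow> A" ..
  have dlim: "d \<longlonglongrightarrow> 0"
    by (rule square_decrease_tendsto_0[where K = 2, OF lim aC(1) d_nonneg dec])
  have inlim: "inertia \<longlonglongrightarrow> 0"
  proof (rule tendsto_sandwich[OF _ _ tendsto_const])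
    have "(\<lambda>k. (\<delta>1 + \<delta>2) * (d k)\<^sup>2) \<longlonglongrightarrow> (\<delta>1 + \<delta>2) * 0\<^sup>2" by (intro tendsto_intros dlim)
    then show "(\<lambda>k. (\<delta>1 + \<delta>2) * (d k)\<^sup>2) \<longlonglongrightarrow> 0" by simp
  qed (use in0 inb in auto)
  have rlim: "r \<longlonglongrightarrow> A"
    using tendsto_diff[OF lim inlim] by (simp add: \<Psi>_def)
  have "bounded (range x)" using bdd by (simp add: x_def[abs_def])
  then obtain xb s where s: "strict_mono s" "(x \<circ> s) \<longlonglongrightarrow> xb"
    using bounded_imp_convergent_subsequence by blast
  note sub = LIMSEQ_subseq_LIMSEQ[OF _ s(1), unfolded o_def]
  have xs: "(\<lambda>n. x (s n)) \<longlonglongrightarrow> xb" using s(2) by (simp add: o_def)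
  have s2: "2 \<le> s (n + 2)" for n using seq_suble[OF s(1), of "n + 2"] by linarith
  have up: "F xb \<le> ereal A"
  proof -
    have "closed {(u, t). F u \<le> ereal t}" by (rule closed_epigraph_if_lsc[OF lscF])
    moreover have "(x (s (n + 2)), r (s (n + 2))) \<in> {(u, t). F u \<le> ereal t}" for n
      using val[OF s2[of n]] by simp
    moreover have "(\<lambda>n. (x (s (n + 2)), r (s (n + 2)))) \<longlonglongrightarrow> (xb, A)"
      by (intro tendsto_Pair LIMSEQ_ignore_initial_segment[OF xs] LIMSEQ_ignore_initial_segment[OF sub[OF rlim]])
    ultimately have "(xb, A) \<in> {(u, t). F u \<le> ereal t}" by (rule closed_sequentially)
    then show ?thesis by simp
  qed
  then obtain Fb where Fb: "F xb = ereal Fb" using properF[of xb] by (cases "F xb") auto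
  \<comment> \<open>The descent estimate with the cluster point itself as comparison point: all
    error terms vanish along the subsequence. With \<open>up\<close> this identifies
    \<open>F xb\<close> as the limit of the function values, as the limiting subdifferential and the
    KL inequality at level \<open>A\<close> require.\<close>
  have "A \<le> Fb"
  proof (rule tendsto_le[OF sequentially_bot])
    let ?n = "\<lambda>n. norm (xb - x (s n))"
    have n0: "?n \<longlonglongrightarrow> 0" using tendsto_norm[OF tendsto_diff[OF tendsto_const xs, of xb]] by simp
    have d1: "(\<lambda>n. d (Suc (s n))) \<longlonglongrightarrow> 0" using sub[OF LIMSEQ_Suc[OF dlim]] .
    show "(\<lambda>n. \<Psi> (Suc (s n))) \<longlonglongrightarrow> A" using sub[OF LIMSEQ_Suc[OF lim]] .
    have "(\<lambda>n. Fb + inertia (s n) + C * (?n n)\<^sup>2 + C * ?n n * (d (Suc (s n)) + d (s n)))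
        \<longlonglongrightarrow> Fb + 0 + C * 0\<^sup>2 + C * 0 * (0 + 0)"
      by (intro tendsto_intros n0 d1 sub[OF dlim] sub[OF inlim])
    then show "(\<lambda>n. Fb + inertia (s n) + C * (?n n)\<^sup>2 + C * ?n n * (d (Suc (s n)) + d (s n))) \<longlonglongrightarrow> Fb"
      by simp
    have "\<forall>\<^sub>F n in sequentially. ?n n < 1" using n0 by (rule order_tendstoD) simp
    moreover have "\<forall>\<^sub>F n in sequentially. 2 \<le> s n"
      using filterlim_subseq[OF s(1)] unfolding filterlim_at_top by blast
    ultimately show "\<forall>\<^sub>F n in sequentially.
        \<Psi> (Suc (s n)) \<le> Fb + inertia (s n) + C * (?n n)\<^sup>2 + C * ?n n * (d (Suc (s n)) + d (s n))"
    proof eventually_elim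
      case (elim n)
      have "0 \<le> a * ((d (Suc (s n)))\<^sup>2 + (d (s n))\<^sup>2)" using aC by simp
      then show ?case using key[of "s n" xb Fb "r (Suc (s n))"] val[of "Suc (s n)"] elim Fb
        by (simp add: \<Psi>_def)
    qed
  qed
  then have FA: "F xb = ereal A" using up Fb by simp
  have crit: "0 \<in> limiting_subdiff F xb"
  proof -
    obtain C' where C': "\<And>k. 1 \<le> k \<Longrightarrow> \<exists>w. w \<in> frechet_subdiff F (x (Suc k)) \<and> norm w \<le> C' * (d (Suc k) + d k)"
      using small_subgradient by blast
    define w where "w k = (SOME w. w \<in> frechet_subdiff F (x (Suc k)) \<and> norm w \<le> C' * (d (Suc k) + d k))" for k
    have w: "w k \<in> frechet_subdiff F (x (Suc k))" "norm (w k) \<le> C' * (d (Suc k) + d k)" if "1 \<le> k" for k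
      using someI_ex[OF C'[OF that]] unfolding w_def by auto
    \<comment> \<open>The shift ensures \<open>t n \<ge> 2\<close>, where subgradients and finite
      values at \<open>Suc (t n)\<close> are available.\<close>
    define t where "t n = s (n + 2)" for n
    have t1: "1 \<le> t n" for n using s2[of n] by (simp add: t_def)
    have t: "strict_mono t" using s(1) by (simp add: t_def strict_mono_def)
    note subt = LIMSEQ_subseq_LIMSEQ[OF _ t, unfolded o_def]
    have xt: "(\<lambda>n. x (t n)) \<longlonglongrightarrow> xb" unfolding t_def by (rule LIMSEQ_ignore_initial_segment[OF xs])
    have dt: "(\<lambda>n. d (t n)) \<longlonglongrightarrow> 0" "(\<lambda>n. d (Suc (t n))) \<longlonglongrightarrow> 0"
      using subt[OF dlim] subt[OF LIMSEQ_Suc[OF dlim]] by auto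
    have "(\<lambda>n. x (Suc (t n)) - x (t n)) \<longlonglongrightarrow> 0"
      by (rule tendsto_norm_zero_cancel) (use dt(2) in \<open>simp add: d_def\<close>)
    from tendsto_add[OF this xt] have y: "(\<lambda>n. x (Suc (t n))) \<longlonglongrightarrow> xb" by simp
    have Fy: "(\<lambda>n. F (x (Suc (t n)))) \<longlonglongrightarrow> F xb"
    proof -
      have "F (x (Suc (t n))) = ereal (r (Suc (t n)))" for n using val t1[of n] by simp
      then show ?thesis using subt[OF LIMSEQ_Suc[OF rlim]] by (simp add: FA)
    qed
    have wl: "(\<lambda>n. w (t n)) \<longlonglongrightarrow> 0"
    proof (rule Lim_null_comparison[of "\<lambda>n. w (t n)" "\<lambda>n. C' * (d (Suc (t n)) + d (t n))"])
      show "\<forall>\<^sub>F n in sequentially. norm (w (t n)) \<le> C' * (d (Suc (t n)) + d (t n))"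
        using w(2)[OF t1] by (rule always_eventually[OF allI])
      have "(\<lambda>n. C' * (d (Suc (t n)) + d (t n))) \<longlonglongrightarrow> C' * (0 + 0)"
        by (intro tendsto_intros dt)
      then show "(\<lambda>n. C' * (d (Suc (t n)) + d (t n))) \<longlonglongrightarrow> 0" by simp
    qed
    have wf: "w (t n) \<in> frechet_subdiff F (x (Suc (t n)))" for n
      by (rule w(1)[OF t1])
    have "xb \<in> edom F" by (simp add: edom_def FA)
    show ?thesis unfolding limiting_subdiff_def if_P[OF \<open>xb \<in> edom F\<close>] mem_Collect_eq
      by (rule exI[of _ "\<lambda>n. x (Suc (t n))"], rule exI[of _ "\<lambda>n. w (t n)"]) (use y Fy wl wf in blast)
  qed
  \<comment> \<open>Criticality has to precede convergence, as the KL property is given on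
    \<open>dom_subdiff F\<close>.\<close>
  have "KL_at F xb" using KL crit unfolding KL_function_def dom_subdiff_def by blast
  have "x \<longlonglongrightarrow> xb"
  \<comment> \<open>By \<open>inb\<close>, this \<open>b\<close> turns the term
    \<open>inertia k\<close> of the descent estimate into the \<open>b * (d k)\<^sup>2\<close> of
    the abstract growth bound.\<close>
  proof (rule converges_to_KL_cluster_point[where K = 2 and d = d and r = r and \<Psi> = \<Psi> and b = "\<delta>1 + \<delta>2",
        OF d_def lscF properF \<open>KL_at F xb\<close> FA val _ aC _ dec lim _ s])
    show "r k \<le> \<Psi> k" for k using in0 by (simp add: \<Psi>_def)
    show "0 \<le> \<delta>1 + \<delta>2" using delta_pos by simp
    fix k u c assume k: "2 \<le> k" and "norm (u - x k) \<le> 1" "F u = ereal c"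
    then show "\<Psi> (Suc k) + a * ((d (Suc k))\<^sup>2 + (d k)\<^sup>2) \<le> c + (\<delta>1 + \<delta>2) * (d k)\<^sup>2
          + C * (norm (u - x k))\<^sup>2 + C * norm (u - x k) * (d (Suc k) + d k)"
      using key[of k u c "r (Suc k)"] val[of "Suc k"] inb[of k] by (simp add: \<Psi>_def)
  qed
  moreover have "critical_point F xb" using crit by (simp add: critical_point_def edom_def FA)
  ultimately show ?thesis by blast
qed

end

theorem theorem4p1:
  fixes f1 :: "real ^ 'n1 \<Rightarrow> ereal" and f2 :: "real ^ 'n2 \<Rightarrow> ereal"
    and H :: "(real ^ 'n1) \<times> (real ^ 'n2) \<Rightarrow> real"
    and L1 :: "real ^ 'n2 \<Rightarrow> real" and L2 :: "real ^ 'n1 \<Rightarrow> real"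
    and lm1 lp1 lm2 lp2 :: real
    and \<epsilon> ab1 ab2 bb1 bb2 :: real
    and \<alpha>1 \<alpha>2 \<beta>1 \<beta>2 \<tau>1 \<tau>2 :: "nat \<Rightarrow> real"
    and x1 :: "nat \<Rightarrow> real ^ 'n1" and x2 :: "nat \<Rightarrow> real ^ 'n2"
  assumes "assumption_A f1 f2 H L1 L2 lm1 lp1 lm2 lp2"
    and "iPALM f1 f2 H \<alpha>1 \<alpha>2 \<beta>1 \<beta>2 \<tau>1 \<tau>2 x1 x2"
    and "0 < \<epsilon>"
    and "assumption_B \<epsilon> ab1 bb1 \<alpha>1 \<beta>1"
    and "assumption_B \<epsilon> ab2 bb2 \<alpha>2 \<beta>2"
    and "step_rule \<epsilon> (step_delta \<epsilon> ab1 bb1 lp1) (step_delta \<epsilon> ab2 bb2 lp2) L1 L2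
           \<alpha>1 \<alpha>2 \<beta>1 \<beta>2 \<tau>1 \<tau>2 x1 x2"
    and "bounded (range (\<lambda>k. (x1 k, x2 k)))"
    and "KL_function (objective f1 f2 H)"
  shows "\<exists>xs. (\<lambda>k. (x1 k, x2 k)) \<longlonglongrightarrow> xs \<and> critical_point (objective f1 f2 H) xs"
proof -
  interpret ipalm_run f1 f2 H L1 L2 lm1 lp1 lm2 lp2 \<epsilon> ab1 ab2 bb1 bb2 \<alpha>1 \<alpha>2 \<beta>1 \<beta>2 \<tau>1 \<tau>2 x1 x2
    using assms by unfold_locales
  show ?thesis using converges_to_critical_point by (simp add: x_def[abs_def])
qed

end
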